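(* If $0<\rho\le1$, $0\le\delta<1$, $\delta\le\rho$ and $a\in APS^0_{\rho,\delta}$, then $a(x,D)$, considered as an operator on $L^2(\mathbb R^d)$, is not compact unless it is zero.
   Context: Notation: $\langle\xi\rangle=(1+|\xi|^2)^{1/2}$, $\widehat f(\xi)=\int f(x)e^{-2\pi ix\cdot\xi}dx$. $C_{\rm ap}(\mathbb R^d)$ is the space of Bohr almost periodic functions, i.e. uniform limits of finite linear combinations of the characters $e^{2\pi i\lambda\cdot x}$, $\lambda\in\mathbb R^d$. $APS^0_{\rho,\delta}$ is the set of $a\in C^\infty(\mathbb R^{2d})$ such that $a(\cdot,\xi)\in C_{\rm ap}(\mathbb R^d)$ for all $\xi$ and $\sup_{x,\xi}\langle\xi\rangle^{\rho|\alpha|-\delta|\beta|}|\partial_\xi^\alpha\partial_x^\beta a(x,\xi)|<\infty$ for all multi-indices $\alpha,\beta$. $a(x,D)f(x)=\int_{\mathbb R^d}e^{2\pi i\xi\cdot x}a(x,\xi)\widehat f(\xi)\,d\xi$ for $f\in\mathscr S(\mathbb R^d)$; for $a\in APS^0_{\rho,\delta}$ it extends to a bounded operator on $L^2(\mathbb R^d)$. *)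

theory Defs
  imports "HOL-Analysis.Analysis"
begin

fun higher_differentiable :: "nat \<Rightarrow> ('a::real_normed_vector \<Rightarrow> 'b::real_normed_vector) \<Rightarrow> bool"
  where
    "higher_differentiable 0 f \<longleftrightarrow> continuous_on UNIV f"
  | "higher_differentiable (Suc k) f \<longleftrightarrow>
       f differentiable_on UNIV \<and>
       (\<forall>v. higher_differentiable k (\<lambda>x. frechet_derivative f (at x) v))"

definition smooth :: "('a::real_normed_vector \<Rightarrow> 'b::real_normed_vector) \<Rightarrow> bool"
  where "smooth f \<longleftrightarrow> (\<forall>k. higher_differentiable k f)"

definition dir_deriv ::
  "'a::real_normed_vector \<Rightarrow> ('a \<Rightarrow> 'b::real_normed_vector) \<Rightarrow> 'a \<Rightarrow> 'b"
  where "dir_deriv v f = (\<lambda>x. frechet_derivative f (at x) v)"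

text \<open>
  A multi-index \<open>\<alpha>\<close> is represented by a list of coordinate indices in which \<open>i\<close> occurs
  \<open>\<alpha>\<^sub>i\<close> times, so that \<open>|\<alpha>|\<close> is its length.  Derivatives are only taken of smooth
  functions, for which the order of the entries is irrelevant.
\<close>

definition partials :: "'n list \<Rightarrow> (real^'n::finite \<Rightarrow> complex) \<Rightarrow> real^'n \<Rightarrow> complex"
  where "partials \<alpha> f = foldr (\<lambda>i. dir_deriv (axis i 1)) \<alpha> f"

definition partials_x ::
  "'n list \<Rightarrow> ((real^'n::finite) \<times> (real^'n) \<Rightarrow> complex) \<Rightarrow> (real^'n) \<times> (real^'n) \<Rightarrow> complex"
  where "partials_x \<beta> a = foldr (\<lambda>i. dir_deriv (axis i 1, 0)) \<beta> a"

definition partials_xi ::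
  "'n list \<Rightarrow> ((real^'n::finite) \<times> (real^'n) \<Rightarrow> complex) \<Rightarrow> (real^'n) \<times> (real^'n) \<Rightarrow> complex"
  where "partials_xi \<alpha> a = foldr (\<lambda>i. dir_deriv (0, axis i 1)) \<alpha> a"

definition jbracket :: "'a::real_normed_vector \<Rightarrow> real"
  where "jbracket \<xi> = sqrt (1 + (norm \<xi>)\<^sup>2)"

definition trig_poly :: "(real^'n::finite \<Rightarrow> complex) \<Rightarrow> bool"
  where "trig_poly p \<longleftrightarrow>
    (\<exists>\<Lambda> c. finite \<Lambda> \<and> p = (\<lambda>x. \<Sum>\<nu>\<in>\<Lambda>. c \<nu> * cis (2 * pi * (\<nu> \<bullet> x))))"

definition bohr_almost_periodic :: "(real^'n::finite \<Rightarrow> complex) \<Rightarrow> bool"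
  where "bohr_almost_periodic f \<longleftrightarrow>
    (\<exists>p. (\<forall>k. trig_poly (p k)) \<and> uniform_limit UNIV p f sequentially)"

definition APS0 :: "real \<Rightarrow> real \<Rightarrow> ((real^'n::finite) \<times> (real^'n) \<Rightarrow> complex) set"
  where "APS0 \<rho> \<delta> = {a.
    smooth a \<and>
    (\<forall>\<xi>. bohr_almost_periodic (\<lambda>x. a (x, \<xi>))) \<and>
    (\<forall>\<alpha> \<beta>. bdd_above (range (\<lambda>(x, \<xi>).
       jbracket \<xi> powr (\<rho> * real (length \<alpha>) - \<delta> * real (length \<beta>))
         * norm (partials_xi \<alpha> (partials_x \<beta> a) (x, \<xi>)))))}"

definition schwartz :: "(real^'n::finite \<Rightarrow> complex) set"
  where "schwartz = {f. smooth f \<and>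
    (\<forall>k \<alpha>. bdd_above (range (\<lambda>x. jbracket x ^ k * norm (partials \<alpha> f x))))}"

definition fourier :: "(real^'n::finite \<Rightarrow> complex) \<Rightarrow> real^'n \<Rightarrow> complex"
  where "fourier f \<xi> = (LINT x|lborel. f x * cis (- (2 * pi * (x \<bullet> \<xi>))))"

definition psdo ::
  "((real^'n::finite) \<times> (real^'n) \<Rightarrow> complex) \<Rightarrow> (real^'n \<Rightarrow> complex) \<Rightarrow> real^'n \<Rightarrow> complex"
  where "psdo a f x = (LINT \<xi>|lborel. cis (2 * pi * (\<xi> \<bullet> x)) * a (x, \<xi>) * fourier f \<xi>)"

definition square_int :: "(real^'n::finite \<Rightarrow> complex) \<Rightarrow> bool"
  where "square_int f \<longleftrightarrow>
    f \<in> borel_measurable lborel \<and> integrable lborel (\<lambda>x. (norm (f x))\<^sup>2)"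

definition l2_rel :: "(real^'n::finite \<Rightarrow> complex) \<Rightarrow> (real^'n \<Rightarrow> complex) \<Rightarrow> bool"
  where "l2_rel f g \<longleftrightarrow> square_int f \<and> square_int g \<and> (AE x in lborel. f x = g x)"

lemma square_int_0: "square_int (\<lambda>x. 0)"
  by (simp add: square_int_def)

lemma square_int_integrable_inner:
  assumes "square_int f" "square_int g"
  shows "integrable lborel (\<lambda>x. f x \<bullet> g x)"
proof (rule Bochner_Integration.integrable_bound)
  show "integrable lborel (\<lambda>x. (norm (f x))\<^sup>2 + (norm (g x))\<^sup>2)"
    using assms by (simp add: square_int_def)
  show "(\<lambda>x. f x \<bullet> g x) \<in> borel_measurable lborel"
    using assms by (auto simp: square_int_def)
  have "\<bar>u \<bullet> v\<bar> \<le> (norm u)\<^sup>2 + (norm v)\<^sup>2" for u v :: complex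
  proof -
    have "\<bar>u \<bullet> v\<bar> \<le> norm u * norm v" by (rule Cauchy_Schwarz_ineq2)
    also have "\<dots> \<le> (norm u)\<^sup>2 + (norm v)\<^sup>2"
      using sum_squares_bound[of "norm u" "norm v"] mult_nonneg_nonneg[of "norm u" "norm v", OF norm_ge_zero norm_ge_zero]
      by linarith
    finally show ?thesis .
  qed
  then show "AE x in lborel. norm (f x \<bullet> g x) \<le> norm ((norm (f x))\<^sup>2 + (norm (g x))\<^sup>2)"
    by simp
qed

lemma square_int_add:
  assumes "square_int f" "square_int g"
  shows "square_int (\<lambda>x. f x + g x)"
proof -
  have "integrable lborel (\<lambda>x. (norm (f x))\<^sup>2 + (norm (g x))\<^sup>2 + 2 * (f x \<bullet> g x))"
    using assms square_int_integrable_inner[OF assms]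
    by (simp add: square_int_def)
  moreover have "(norm (u + v))\<^sup>2 = (norm u)\<^sup>2 + (norm v)\<^sup>2 + 2 * (u \<bullet> v)" for u v :: complex
    by (simp add: power2_norm_eq_inner inner_add inner_commute)
  ultimately show ?thesis
    using assms by (auto simp: square_int_def)
qed

lemma square_int_scaleR: "square_int f \<Longrightarrow> square_int (\<lambda>x. r *\<^sub>R f x)"
  by (auto simp: square_int_def power_mult_distrib)

lemma square_int_uminus: "square_int f \<Longrightarrow> square_int (\<lambda>x. - f x)"
  by (simp add: square_int_def)

lemma square_int_diff:
  "square_int f \<Longrightarrow> square_int g \<Longrightarrow> square_int (\<lambda>x. f x - g x)"
  using square_int_add[of f "\<lambda>x. - g x"] square_int_uminus[of g] by simp

lemma square_int_norm_cong:
  assumes "AE x in lborel. f x = g x" "square_int f" "square_int g"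
  shows "(LINT x|lborel. (norm (f x))\<^sup>2) = (LINT x|lborel. (norm (g x))\<^sup>2)"
  using assms by (intro integral_cong_AE) (auto simp: square_int_def)

quotient_type 'n l2 = "(real^'n::finite) \<Rightarrow> complex" / partial: l2_rel
proof (rule part_equivpI)
  show "\<exists>f :: real^'n \<Rightarrow> complex. l2_rel f f"
    using square_int_0 by (auto simp: l2_rel_def)
  show "symp (l2_rel :: (real^'n \<Rightarrow> complex) \<Rightarrow> _)"
    by (auto simp: symp_def l2_rel_def)
  show "transp (l2_rel :: (real^'n \<Rightarrow> complex) \<Rightarrow> _)"
    by (rule transpI) (auto simp: l2_rel_def)
qed

text \<open>
  The space is regarded as a real Hilbert space with the real part of the usual inner product;
  the norm is the usual one.
\<close>

instantiation l2 :: (finite) real_inner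
begin

lift_definition zero_l2 :: "'a l2" is "\<lambda>x. 0"
  by (simp add: l2_rel_def square_int_0)

lift_definition plus_l2 :: "'a l2 \<Rightarrow> 'a l2 \<Rightarrow> 'a l2" is "\<lambda>f g x. f x + g x"
  by (auto simp: l2_rel_def intro!: square_int_add)

lift_definition minus_l2 :: "'a l2 \<Rightarrow> 'a l2 \<Rightarrow> 'a l2" is "\<lambda>f g x. f x - g x"
  by (auto simp: l2_rel_def intro!: square_int_diff)

lift_definition uminus_l2 :: "'a l2 \<Rightarrow> 'a l2" is "\<lambda>f x. - f x"
  by (auto simp: l2_rel_def intro!: square_int_uminus)

lift_definition scaleR_l2 :: "real \<Rightarrow> 'a l2 \<Rightarrow> 'a l2" is "\<lambda>r f x. r *\<^sub>R f x"
  by (auto simp: l2_rel_def intro!: square_int_scaleR)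

lift_definition inner_l2 :: "'a l2 \<Rightarrow> 'a l2 \<Rightarrow> real" is "\<lambda>f g. LINT x|lborel. f x \<bullet> g x"
  by (rule integral_cong_AE) (auto simp: l2_rel_def square_int_def)

lift_definition norm_l2 :: "'a l2 \<Rightarrow> real" is "\<lambda>f. sqrt (LINT x|lborel. (norm (f x))\<^sup>2)"
  by (auto simp: l2_rel_def dest: square_int_norm_cong)

definition sgn_l2 :: "'a l2 \<Rightarrow> 'a l2"
  where "sgn_l2 u = inverse (norm u) *\<^sub>R u"

definition dist_l2 :: "'a l2 \<Rightarrow> 'a l2 \<Rightarrow> real"
  where "dist_l2 u v = norm (u - v)"

definition uniformity_l2 :: "('a l2 \<times> 'a l2) filter"
  where "uniformity_l2 = (INF e\<in>{0<..}. principal {(u, v). dist u v < e})"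

definition open_l2 :: "'a l2 set \<Rightarrow> bool"
  where "open_l2 U \<longleftrightarrow> (\<forall>u\<in>U. \<forall>\<^sub>F (u', v) in uniformity. u' = u \<longrightarrow> v \<in> U)"

instance
proof
  fix u v w :: "'a l2" and r s :: real and U :: "'a l2 set"
  show "u + v + w = u + (v + w)"
    by transfer (auto simp: l2_rel_def add.assoc intro!: square_int_add)
  show "u + v = v + u"
    by transfer (auto simp: l2_rel_def add.commute intro!: square_int_add)
  show "0 + u = u"
    by transfer (auto simp: l2_rel_def)
  show "- u + u = 0"
    by transfer (auto simp: l2_rel_def square_int_0)
  show "u - v = u + - v"
    by transfer (auto simp: l2_rel_def intro!: square_int_diff)
  show "r *\<^sub>R (u + v) = r *\<^sub>R u + r *\<^sub>R v"
    by transfer (auto simp: l2_rel_def scaleR_add_right intro!: square_int_add square_int_scaleR)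
  show "(r + s) *\<^sub>R u = r *\<^sub>R u + s *\<^sub>R u"
    by transfer (auto simp: l2_rel_def scaleR_add_left intro!: square_int_add square_int_scaleR)
  show "r *\<^sub>R s *\<^sub>R u = (r * s) *\<^sub>R u"
    by transfer (auto simp: l2_rel_def intro!: square_int_scaleR)
  show "1 *\<^sub>R u = u"
    by transfer (auto simp: l2_rel_def)
  show "dist u v = norm (u - v)"
    by (rule dist_l2_def)
  show "sgn u = inverse (norm u) *\<^sub>R u"
    by (rule sgn_l2_def)
  show "(uniformity :: ('a l2 \<times> 'a l2) filter)
      = (INF e\<in>{0<..}. principal {(u, v). dist u v < e})"
    by (rule uniformity_l2_def)
  show "open U \<longleftrightarrow> (\<forall>u\<in>U. \<forall>\<^sub>F (u', v) in uniformity. u' = u \<longrightarrow> v \<in> U)"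
    by (rule open_l2_def)
  show "u \<bullet> v = v \<bullet> u"
    by transfer (simp add: inner_commute)
  show "(u + v) \<bullet> w = u \<bullet> w + v \<bullet> w"
    by transfer (auto simp: l2_rel_def inner_add_left square_int_integrable_inner)
  show "(r *\<^sub>R u) \<bullet> v = r * (u \<bullet> v)"
    by transfer simp
  show "0 \<le> u \<bullet> u"
    by transfer simp
  show "u \<bullet> u = 0 \<longleftrightarrow> u = 0"
  proof transfer
    fix f :: "real^'a \<Rightarrow> complex"
    assume "l2_rel f f"
    then have f: "square_int f" by (simp add: l2_rel_def)
    have "(LINT x|lborel. f x \<bullet> f x) = 0 \<longleftrightarrow> (AE x in lborel. f x \<bullet> f x = 0)"
      using square_int_integrable_inner[OF f f] by (intro integral_nonneg_eq_0_iff_AE) auto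
    then show "(LINT x|lborel. f x \<bullet> f x) = 0 \<longleftrightarrow> l2_rel f (\<lambda>x. 0)"
      using f by (simp add: l2_rel_def square_int_0)
  qed
  show "norm u = sqrt (u \<bullet> u)"
    by transfer (simp add: power2_norm_eq_inner)
qed

end

definition compact_operator :: "('a::real_normed_vector \<Rightarrow> 'b::real_normed_vector) \<Rightarrow> bool"
  where "compact_operator T \<longleftrightarrow> bounded_linear T \<and> compact (closure (T ` cball 0 1))"

text \<open>
  \<open>T\<close> is the bounded extension of \<open>a(x,D)\<close> from the Schwartz space.  Only real linearity is
  required of \<open>T\<close>, but by density of the Schwartz space there is at most one such \<open>T\<close>, and it
  commutes with multiplication by \<open>\<i>\<close> because \<open>a(x,D)\<close> does.
\<close>

definition psdo_l2_extension ::
  "((real^'n::finite) \<times> (real^'n) \<Rightarrow> complex) \<Rightarrow> ('n l2 \<Rightarrow> 'n l2) \<Rightarrow> bool"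
  where "psdo_l2_extension a T \<longleftrightarrow>
    bounded_linear T \<and>
    (\<forall>f\<in>schwartz. AE x in lborel. rep_l2 (T (abs_l2 f)) x = psdo a f x)"

end

theory Submission
  imports Defs "HOL-Probability.Characteristic_Functions" "HOL-Complex_Analysis.Great_Picard"
    "HOL-Real_Asymp.Real_Asymp"
begin

text \<open>
  By almost periodicity there are \<open>h\<^sub>n \<rightarrow> \<infinity>\<close> with \<open>a(x + h\<^sub>n, \<xi>) \<rightarrow> a(x, \<xi>)\<close> for all \<open>x\<close> and \<open>\<xi>\<close>: a diagonal
  argument handles countably many frequencies, hence a dense set of \<open>\<xi>\<close>, and \<open>a\<close> is Lipschitz
  in \<open>\<xi>\<close> uniformly in \<open>x\<close>.  Let \<open>f\<close> be a modulated Gaussian and \<open>u\<^sub>n\<close> its translate by \<open>h\<^sub>n\<close>.  Then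
  \<open>u\<^sub>n \<rightarrow> 0\<close> weakly, so compactness gives \<open>T u\<^sub>n \<rightarrow> 0\<close> in norm along a subsequence.  Translating back,
  \<open>(T u\<^sub>n)(x + h\<^sub>n) \<rightarrow> (T f)(x)\<close> pointwise, so \<open>T f = 0\<close> by Fatou's lemma.  Modulated Gaussians
  span a dense subspace, so \<open>T = 0\<close>.
\<close>

subsection \<open>Weakly null sequences and compact operators\<close>

text \<open>Conjugating \<open>a(x,D)\<close> with translation by h replaces its symbol by a(x + h,
  \<xi>), so recurrence makes the operator commute asymptotically with translations tending to
  infinity; this is what compactness cannot tolerate. Frequency sets of the functions a(., \<xi>)
  vary with \<xi> and their union may be uncountable, so no sequence is chosen for all \<xi>
  directly. Convergence of the shifted symbols pointwise in x and \<xi> is all that is asked: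
  \<open>a\<close> is bounded and the Fourier transform of a Gaussian is integrable, which gives
  dominated convergence in \<xi>, and Fatou's lemma in x needs only convergence almost everywhere of
  representatives. Gaussians serve as test functions because their Fourier transforms are explicit.
  T is assumed only real linear, so the test functions carry a complex factor c, and T is shown to
  vanish for every c without appeal to compatibility with \<i>. Density is obtained by enlarging the
  kernel of T through bounded pointwise limits, up to all bounded Borel functions times a
  Gaussian.\<close>

text \<open>
  Averaging replaces the adjoint, whose existence would need completeness of the domain: sums of
  \<open>k\<close> almost orthogonal terms have norm \<open>O(\<surd>k)\<close>, whereas their images grow linearly if \<open>w \<noteq> 0\<close>.
\<close>

lemma weakly_null_image_limit_eq_0:
  fixes T :: "'a::real_inner \<Rightarrow> 'b::real_inner"
  assumes T: "bounded_linear T"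
    and M: "\<And>n. norm (u n) \<le> M"
    and weak: "\<And>n. (\<lambda>m. u n \<bullet> u m) \<longlonglongrightarrow> 0"
    and lim: "(\<lambda>n. T (u n)) \<longlonglongrightarrow> w"
  shows "w = 0"
proof (rule ccontr)
  assume "w \<noteq> 0"
  interpret T: bounded_linear T by fact
  define d where "d = (w \<bullet> w) / 2"
  have d: "0 < d" using \<open>w \<noteq> 0\<close> by (simp add: d_def)
  have "(\<lambda>n. T (u n) \<bullet> w) \<longlonglongrightarrow> w \<bullet> w"
    by (intro tendsto_intros lim)
  moreover have "d < w \<bullet> w" using d by (simp add: d_def)
  ultimately have ev: "\<forall>\<^sub>F n in sequentially. d < T (u n) \<bullet> w"
    by (rule order_tendstoD)
  \<comment> \<open>Each new term adds at most \<open>M\<^sup>2\<close> from its own norm; the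
    summand 1 absorbs twice its inner product with the earlier sum, which is kept below 1/2.\<close>
  define B where "B = M\<^sup>2 + 1"
  have B: "0 < B" by (simp add: B_def add_nonneg_pos)
  \<comment> \<open>The first conjunct keeps the sum asymptotically orthogonal to the sequence,
    which is what allows the next term to be chosen.\<close>
  have sums: "\<exists>s. (\<lambda>m. s \<bullet> u m) \<longlonglongrightarrow> 0 \<and> (norm s)\<^sup>2 \<le> real k * B \<and> real k * d \<le> T s \<bullet> w" for k
  proof (induction k)
    case 0
    show ?case by (intro exI[of _ 0]) (simp add: T.zero)
  next
    case (Suc k)
    then obtain s where s: "(\<lambda>m. s \<bullet> u m) \<longlonglongrightarrow> 0" "(norm s)\<^sup>2 \<le> real k * B"
      "real k * d \<le> T s \<bullet> w" by blast
    have "\<forall>\<^sub>F m in sequentially. s \<bullet> u m < 1/2"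
      using order_tendstoD(2)[OF s(1), of "1/2"] by simp
    with ev have "\<forall>\<^sub>F m in sequentially. d < T (u m) \<bullet> w \<and> s \<bullet> u m < 1/2"
      by (rule eventually_conj)
    then obtain m where m: "d < T (u m) \<bullet> w" "s \<bullet> u m < 1/2"
      by (auto dest: eventually_happens)
    have "(norm (s + u m))\<^sup>2 = (norm s)\<^sup>2 + (norm (u m))\<^sup>2 + 2 * (s \<bullet> u m)"
      by (simp add: power2_norm_eq_inner inner_add inner_commute)
    moreover have "(norm (u m))\<^sup>2 \<le> M\<^sup>2"
      by (rule power_mono) (auto simp: M)
    ultimately have "(norm (s + u m))\<^sup>2 \<le> real (Suc k) * B"
      using s(2) m(2) by (simp add: B_def algebra_simps)
    moreover have "(\<lambda>j. (s + u m) \<bullet> u j) \<longlonglongrightarrow> 0"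
      using tendsto_add[OF s(1) weak[of m]] by (simp add: inner_add_left)
    moreover have "real (Suc k) * d \<le> T (s + u m) \<bullet> w"
      using s(3) m(1) by (simp add: T.add inner_add_left algebra_simps)
    ultimately show ?case by blast
  qed
  obtain K where K: "\<And>x. norm (T x) \<le> norm x * K" and "0 < K"
    using T.pos_bounded by blast
  define C where "C = (K * norm w)\<^sup>2 * B"
  have bound: "(real k * d)\<^sup>2 \<le> real k * C" for k
  proof -
    obtain s where s: "(norm s)\<^sup>2 \<le> real k * B" "real k * d \<le> T s \<bullet> w"
      using sums[of k] by blast
    have "real k * d \<le> norm (T s) * norm w"
      using s(2) norm_cauchy_schwarz[of "T s" w] by linarith
    also have "\<dots> \<le> (norm s * K) * norm w"
      by (intro mult_right_mono K) simp
    finally have "(real k * d)\<^sup>2 \<le> ((norm s * K) * norm w)\<^sup>2"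
      using d by (intro power_mono) auto
    also have "\<dots> = (norm s)\<^sup>2 * (K * norm w)\<^sup>2"
      by (simp add: power_mult_distrib)
    also have "\<dots> \<le> (real k * B) * (K * norm w)\<^sup>2"
      by (intro mult_right_mono s) simp
    finally show ?thesis by (simp add: C_def mult_ac)
  qed
  obtain k :: nat where k: "C / d\<^sup>2 < real k" using reals_Archimedean2 by blast
  have "0 \<le> C" using B by (simp add: C_def)
  then have "0 < real k"
    using k by (smt (verit) divide_nonneg_nonneg zero_le_power2)
  moreover have "C < real k * d\<^sup>2"
    using k d by (simp add: divide_simps)
  ultimately have "real k * C < real k * (real k * d\<^sup>2)"
    by simp
  with bound[of k] show False
    by (simp add: power2_eq_square mult_ac)
qed

lemma compact_operator_weakly_null:
  fixes T :: "'a::real_inner \<Rightarrow> 'b::real_inner"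
  assumes "compact_operator T"
    and M: "\<And>n. norm (u n) \<le> M"
    and weak: "\<And>n. (\<lambda>m. u n \<bullet> u m) \<longlonglongrightarrow> 0"
  obtains r :: "nat \<Rightarrow> nat" where "strict_mono r" "(\<lambda>n. T (u (r n))) \<longlonglongrightarrow> 0"
proof -
  have T: "bounded_linear T" and comp: "compact (closure (T ` cball 0 1))"
    using assms(1) by (auto simp: compact_operator_def)
  interpret T: bounded_linear T by fact
  define c where "c = max M 1"
  have c: "0 < c" "\<And>n. norm (u n) \<le> c"
    using M by (auto simp: c_def intro: order_trans le_max_iff_disj[THEN iffD2])
  have "T (u n /\<^sub>R c) \<in> closure (T ` cball 0 1)" for n
    using c by (intro subsetD[OF closure_subset] imageI) (auto simp: divide_simps)
  then obtain l r where r: "strict_mono r" "((\<lambda>n. T (u n /\<^sub>R c)) \<circ> r) \<longlonglongrightarrow> l"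
    using comp unfolding compact_def by metis
  from tendsto_scaleR[OF tendsto_const[of c] r(2)]
  have lim: "(\<lambda>n. T (u (r n))) \<longlonglongrightarrow> c *\<^sub>R l"
    using c by (simp add: T.scaleR o_def)
  moreover have "c *\<^sub>R l = 0"
  proof (rule weakly_null_image_limit_eq_0[OF T _ _ lim])
    show "norm (u (r n)) \<le> M" for n by (rule M)
    show "(\<lambda>m. u (r n) \<bullet> u (r m)) \<longlonglongrightarrow> 0" for n
      using LIMSEQ_subseq_LIMSEQ[OF weak r(1)] by (simp add: o_def)
  qed
  ultimately show ?thesis using that r(1) by simp
qed

subsection \<open>Recurrence of almost periodic functions\<close>

text \<open>Compactness of a countable product of circles: along some subsequence \<open>k\<close>
  of the multiples of a unit vector all characters in \<open>N\<close> converge. Differences of two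
  terms of that subsequence are return times, since the limits have modulus 1 and the quotient of
  two values with the same limit tends to 1.\<close>

lemma simultaneous_recurrence:
  fixes N :: "(real^'n::finite) set"
  assumes "countable N"
  obtains h :: "nat \<Rightarrow> real^'n" where "filterlim (\<lambda>n. norm (h n)) at_top sequentially"
    and "\<And>\<nu>. \<nu> \<in> N \<Longrightarrow> (\<lambda>n. cis (2 * pi * (\<nu> \<bullet> h n))) \<longlonglongrightarrow> 1"
proof -
  obtain e :: "real^'n" where e: "norm e = 1"
    using vector_choose_size[of 1] by auto
  define f where "f = (\<lambda>(n::nat) \<nu>. cis (2 * pi * (\<nu> \<bullet> (real n *\<^sub>R e))))"
  have "norm (f n \<nu>) \<le> 1" for n \<nu> by (simp add: f_def)
  then obtain k where k: "strict_mono (k::nat\<Rightarrow>nat)"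
    and lim: "\<And>\<nu>. \<nu> \<in> N \<Longrightarrow> \<exists>l. (\<lambda>n. f (k n) \<nu>) \<longlonglongrightarrow> l"
    using function_convergent_subsequence[OF assms, of f 1] by blast
  \<comment> \<open>As \<open>k j\<close> is at least j, this index forces a gap of at least n
    between \<open>k (q n)\<close> and \<open>k n\<close>, so the differences are unbounded.\<close>
  define q where "q n = k n + n" for n
  define h where "h n = (real (k (q n)) - real (k n)) *\<^sub>R e" for n
  have ge: "real (k n) + real n \<le> real (k (q n))" for n
    using seq_suble[OF k, of "q n"] by (simp add: q_def)
  have "filterlim (\<lambda>n. norm (h n)) at_top sequentially"
  proof (rule filterlim_at_top_mono[OF filterlim_real_sequentially])
    show "\<forall>\<^sub>F n in sequentially. real n \<le> norm (h n)"
      using ge by (intro always_eventually allI) (simp add: h_def e, smt (verit))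
  qed
  moreover have "(\<lambda>n. cis (2 * pi * (\<nu> \<bullet> h n))) \<longlonglongrightarrow> 1" if \<nu>: "\<nu> \<in> N" for \<nu>
  proof -
    obtain l where l: "(\<lambda>n. f (k n) \<nu>) \<longlonglongrightarrow> l" using lim[OF \<nu>] by blast
    have "strict_mono q"
      using k by (auto simp: q_def strict_mono_def intro: add_strict_mono)
    from LIMSEQ_subseq_LIMSEQ[OF l this]
    have l': "(\<lambda>n. f (k (q n)) \<nu>) \<longlonglongrightarrow> l" by (simp add: o_def)
    have "norm l = 1"
      using LIMSEQ_unique[OF tendsto_norm[OF l]] by (simp add: f_def)
    then have "l * cnj l = 1" using complex_norm_square[of l] by simp
    moreover have "(\<lambda>n. f (k (q n)) \<nu> * cnj (f (k n) \<nu>)) \<longlonglongrightarrow> l * cnj l"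
      by (intro tendsto_intros l l')
    moreover have "f (k (q n)) \<nu> * cnj (f (k n) \<nu>) = cis (2 * pi * (\<nu> \<bullet> h n))" for n
      by (simp add: f_def h_def cis_cnj cis_mult algebra_simps)
    ultimately show ?thesis by simp
  qed
  ultimately show ?thesis by (rule that)
qed

lemma trig_poly_shift_tendsto:
  assumes "trig_poly p"
  obtains N where "countable N"
    and "\<And>h x. (\<And>\<nu>. \<nu> \<in> N \<Longrightarrow> (\<lambda>n::nat. cis (2 * pi * (\<nu> \<bullet> h n))) \<longlonglongrightarrow> 1) \<Longrightarrow>
      (\<lambda>n. p (x + h n)) \<longlonglongrightarrow> p x"
proof -
  obtain N c where N: "finite N" and p: "p = (\<lambda>x. \<Sum>\<nu>\<in>N. c \<nu> * cis (2 * pi * (\<nu> \<bullet> x)))"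
    using assms unfolding trig_poly_def by blast
  have "(\<lambda>n. p (x + h n)) \<longlonglongrightarrow> p x"
    if h: "\<And>\<nu>. \<nu> \<in> N \<Longrightarrow> (\<lambda>n::nat. cis (2 * pi * (\<nu> \<bullet> h n))) \<longlonglongrightarrow> 1" for h x
  proof -
    have "(\<lambda>n. \<Sum>\<nu>\<in>N. c \<nu> * cis (2 * pi * (\<nu> \<bullet> x)) * cis (2 * pi * (\<nu> \<bullet> h n)))
        \<longlonglongrightarrow> (\<Sum>\<nu>\<in>N. c \<nu> * cis (2 * pi * (\<nu> \<bullet> x)) * 1)"
      by (intro tendsto_intros h)
    then show ?thesis
      by (simp add: p inner_add_right distrib_left mult.assoc flip: cis_mult)
  qed
  then show ?thesis using that countable_finite[OF N] by blast
qed

text \<open>The approximating trigonometric polynomials have countably many frequencies in total.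
  Their approximation is uniform over all points, in particular over the shifts, so the limits in k
  and n may be exchanged.\<close>

lemma bohr_almost_periodic_shift_tendsto:
  assumes "bohr_almost_periodic f"
  obtains N where "countable N"
    and "\<And>h x. (\<And>\<nu>. \<nu> \<in> N \<Longrightarrow> (\<lambda>n::nat. cis (2 * pi * (\<nu> \<bullet> h n))) \<longlonglongrightarrow> 1) \<Longrightarrow>
      (\<lambda>n. f (x + h n)) \<longlonglongrightarrow> f x"
proof -
  obtain p where p: "\<And>k. trig_poly (p k)" and lim: "uniform_limit UNIV p f sequentially"
    using assms unfolding bohr_almost_periodic_def by blast
  have "\<exists>N. countable N \<and> (\<forall>h x. (\<forall>\<nu>\<in>N. (\<lambda>n::nat. cis (2 * pi * (\<nu> \<bullet> h n))) \<longlonglongrightarrow> 1) \<longrightarrow>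
      (\<lambda>n. p k (x + h n)) \<longlonglongrightarrow> p k x)" for k
    using trig_poly_shift_tendsto[OF p[of k]] by metis
  then obtain N where N: "\<And>k. countable (N k)"
    and Np: "\<And>k h x. (\<And>\<nu>. \<nu> \<in> N k \<Longrightarrow> (\<lambda>n::nat. cis (2 * pi * (\<nu> \<bullet> h n))) \<longlonglongrightarrow> 1) \<Longrightarrow>
      (\<lambda>n. p k (x + h n)) \<longlonglongrightarrow> p k x"
    by metis
  have "(\<lambda>n. f (x + h n)) \<longlonglongrightarrow> f x"
    if h: "\<And>\<nu>. \<nu> \<in> (\<Union>k. N k) \<Longrightarrow> (\<lambda>n::nat. cis (2 * pi * (\<nu> \<bullet> h n))) \<longlonglongrightarrow> 1" for h x
  proof (rule swap_uniform_limit'[where f = "\<lambda>k n. p k (x + h n)" and g = "\<lambda>k. p k x" and F = sequentially and S = UNIV])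
    show "\<forall>\<^sub>F k in sequentially. ((\<lambda>n. p k (x + h n)) \<longlongrightarrow> p k x) sequentially"
      by (intro always_eventually allI Np h) blast
    show "((\<lambda>k. p k x) \<longlongrightarrow> f x) sequentially"
      using tendsto_uniform_limitI[OF lim] by simp
    show "uniform_limit UNIV (\<lambda>k n. p k (x + h n)) (\<lambda>n. f (x + h n)) sequentially"
      unfolding uniform_limit_iff
    proof (intro allI impI)
      fix e :: real assume "0 < e"
      with lim have "\<forall>\<^sub>F k in sequentially. \<forall>x\<in>UNIV. dist (p k x) (f x) < e"
        unfolding uniform_limit_iff by blast
      then show "\<forall>\<^sub>F k in sequentially. \<forall>n\<in>UNIV. dist (p k (x + h n)) (f (x + h n)) < e"
        by (rule eventually_mono) blast
    qed
  qed simp_all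
  moreover have "countable (\<Union>k. N k)" using N by simp
  ultimately show ?thesis using that by blast
qed

subsection \<open>Symbols\<close>

lemma APS0_continuous: "a \<in> APS0 \<rho> \<delta> \<Longrightarrow> continuous_on UNIV a"
  by (auto simp: APS0_def smooth_def dest!: spec[of "higher_differentiable 0"] spec[of _ "0::nat"])

lemma APS0_seminorm:
  fixes a :: "(real^'n::finite) \<times> (real^'n) \<Rightarrow> complex" and \<alpha> \<beta> :: "'n list"
  assumes "a \<in> APS0 \<rho> \<delta>"
  shows "bdd_above (range (\<lambda>(x, \<xi>).
       jbracket \<xi> powr (\<rho> * real (length \<alpha>) - \<delta> * real (length \<beta>))
         * norm (partials_xi \<alpha> (partials_x \<beta> a) (x, \<xi>))))"
  using assms by (simp add: APS0_def)

lemma APS0_bounded: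
  fixes a :: "(real^'n::finite) \<times> (real^'n) \<Rightarrow> complex"
  assumes "a \<in> APS0 \<rho> \<delta>"
  obtains B where "\<And>z. norm (a z) \<le> B"
proof -
  note APS0_seminorm[OF assms, of "[]" "[]"]
  \<comment> \<open>For empty index lists the weight is \<open>jbracket \<xi> powr 0\<close>, which
    is 1 only because the base is nonzero: \<open>0 powr 0\<close> is 0.\<close>
  moreover have "jbracket y \<noteq> 0" for y :: "real^'n"
    unfolding jbracket_def using zero_le_power2[of "norm y"] by (smt (verit) real_sqrt_eq_zero_cancel_iff)
  ultimately have "bdd_above (range (\<lambda>z. norm (a z)))"
    by (simp add: partials_xi_def partials_x_def case_prod_unfold)
  then show ?thesis
    using that by (auto simp: bdd_above_def)
qed

text \<open>Mean value inequality with the first-order seminorms in \<xi>: their weight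
  \<open>jbracket \<xi> powr \<rho>\<close> is at least 1, so the partial derivatives themselves are
  bounded. The constant does not depend on x and therefore serves at all shifted points at
  once.\<close>

lemma APS0_lipschitz_xi:
  fixes a :: "(real^'n::finite) \<times> (real^'n) \<Rightarrow> complex"
  assumes a: "a \<in> APS0 \<rho> \<delta>" and "0 \<le> \<rho>"
  obtains C where "0 \<le> C" "\<And>x \<xi> \<eta>. norm (a (x, \<xi>) - a (x, \<eta>)) \<le> C * norm (\<xi> - \<eta>)"
proof -
  have "higher_differentiable (Suc 0) a"
    using a unfolding APS0_def smooth_def by blast
  then have "a differentiable (at z)" for z
    by (cases z) (simp add: differentiable_on_def)
  then have der: "(a has_derivative frechet_derivative a (at z)) (at z)" for z
    by (simp flip: frechet_derivative_works)
  have "\<exists>C. \<forall>z. norm (frechet_derivative a (at z) (0, axis i 1)) \<le> C" for i :: 'n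
  proof -
    note APS0_seminorm[OF a, of "[i]" "[]"]
    then obtain C where C: "\<And>x \<xi>. jbracket \<xi> powr \<rho>
          * norm (frechet_derivative a (at (x, \<xi>)) (0, axis i 1)) \<le> C"
      by (auto simp: bdd_above_def partials_xi_def partials_x_def dir_deriv_def)
    have "norm (frechet_derivative a (at (x, \<xi>)) (0, axis i 1)) \<le> C" for x \<xi>
    proof -
      have "1 \<le> jbracket \<xi> powr \<rho>"
        using \<open>0 \<le> \<rho>\<close> by (intro ge_one_powr_ge_zero) (auto simp: jbracket_def)
      then have "1 * norm (frechet_derivative a (at (x, \<xi>)) (0, axis i 1))
          \<le> jbracket \<xi> powr \<rho> * norm (frechet_derivative a (at (x, \<xi>)) (0, axis i 1))"
        by (intro mult_right_mono) auto
      with C[of \<xi> x] show ?thesis by simp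
    qed
    then show ?thesis by auto
  qed
  then obtain C where C: "\<And>i z. norm (frechet_derivative a (at z) (0, axis i 1)) \<le> C i" by metis
  have C0: "0 \<le> C i" for i using C[of undefined i] norm_ge_zero order_trans by blast
  have der2: "((\<lambda>\<xi>. a (x, \<xi>)) has_derivative (\<lambda>v. frechet_derivative a (at (x, \<xi>)) (0, v))) (at \<xi>)" for x \<xi>
    by (rule has_derivative_compose[OF _ der]) (auto intro!: derivative_eq_intros)
  have on: "onorm (\<lambda>v. frechet_derivative a (at (x, \<xi>)) (0, v)) \<le> (\<Sum>i\<in>UNIV. C i)" for x \<xi>
  proof (rule onorm_bound)
    show "0 \<le> (\<Sum>i\<in>UNIV. C i)" using C0 by (simp add: sum_nonneg)
    fix v :: "real^'n"
    interpret F: bounded_linear "\<lambda>v. frechet_derivative a (at (x, \<xi>)) (0, v)"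
      using der2 by (rule has_derivative_bounded_linear)
    have "frechet_derivative a (at (x, \<xi>)) (0, v)
        = frechet_derivative a (at (x, \<xi>)) (0, \<Sum>i\<in>UNIV. (v $ i) *\<^sub>R axis i 1)"
      using basis_expansion[of v] by (simp add: scalar_mult_eq_scaleR)
    also have "\<dots> = (\<Sum>i\<in>UNIV. (v $ i) *\<^sub>R frechet_derivative a (at (x, \<xi>)) (0, axis i 1))"
      by (simp add: F.sum F.scaleR)
    also have "norm \<dots> \<le> (\<Sum>i\<in>UNIV. \<bar>v $ i\<bar> * C i)"
      by (intro order_trans[OF norm_sum] sum_mono) (simp add: mult_left_mono C)
    also have "\<dots> \<le> (\<Sum>i\<in>UNIV. norm v * C i)"
      by (intro sum_mono mult_right_mono component_le_norm_cart C0)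
    finally show "norm (frechet_derivative a (at (x, \<xi>)) (0, v)) \<le> (\<Sum>i\<in>UNIV. C i) * norm v"
      by (simp add: sum_distrib_left mult.commute)
  qed
  have "norm (a (x, \<xi>) - a (x, \<eta>)) \<le> (\<Sum>i\<in>UNIV. C i) * norm (\<xi> - \<eta>)" for x \<xi> \<eta>
    by (rule differentiable_bound[of UNIV "\<lambda>\<xi>. a (x, \<xi>)"
          "\<lambda>\<xi> v. frechet_derivative a (at (x, \<xi>)) (0, v)"])
      (auto intro: der2 on)
  then show ?thesis using that[of "\<Sum>i\<in>UNIV. C i"] C0 by (simp add: sum_nonneg)
qed

lemma APS0_recurrence:
  fixes a :: "(real^'n::finite) \<times> (real^'n) \<Rightarrow> complex"
  assumes a: "a \<in> APS0 \<rho> \<delta>" and "0 \<le> \<rho>"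
  obtains h :: "nat \<Rightarrow> real^'n" where "filterlim (\<lambda>n. norm (h n)) at_top sequentially"
    and "\<And>x \<xi>. (\<lambda>n. a (x + h n, \<xi>)) \<longlonglongrightarrow> a (x, \<xi>)"
proof -
  obtain C where C: "0 \<le> C" "\<And>x \<xi> \<eta>. norm (a (x, \<xi>) - a (x, \<eta>)) \<le> C * norm (\<xi> - \<eta>)"
    using APS0_lipschitz_xi[OF a \<open>0 \<le> \<rho>\<close>] by blast
  obtain D :: "(real^'n) set" where D: "countable D" "\<And>U. open U \<Longrightarrow> U \<noteq> {} \<Longrightarrow> \<exists>d\<in>D. d \<in> U"
    by (erule countable_dense_setE)
  have "bohr_almost_periodic (\<lambda>x. a (x, \<xi>))" for \<xi>
    using a by (simp add: APS0_def)
  from bohr_almost_periodic_shift_tendsto[OF this]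
  have "\<exists>N. countable N \<and> (\<forall>h x. (\<forall>\<nu>\<in>N. (\<lambda>n::nat. cis (2 * pi * (\<nu> \<bullet> h n))) \<longlonglongrightarrow> 1) \<longrightarrow>
      (\<lambda>n. a (x + h n, \<xi>)) \<longlonglongrightarrow> a (x, \<xi>))" for \<xi>
    by metis
  then obtain N where N: "\<And>\<xi>. countable (N \<xi>)"
    and lim: "\<And>\<xi> h x. (\<And>\<nu>. \<nu> \<in> N \<xi> \<Longrightarrow> (\<lambda>n::nat. cis (2 * pi * (\<nu> \<bullet> h n))) \<longlonglongrightarrow> 1) \<Longrightarrow>
      (\<lambda>n. a (x + h n, \<xi>)) \<longlonglongrightarrow> a (x, \<xi>)"
    by metis
  have "countable (\<Union>\<xi>\<in>D. N \<xi>)" using D N by blast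
  then obtain h :: "nat \<Rightarrow> real^'n" where h: "filterlim (\<lambda>n. norm (h n)) at_top sequentially"
    "\<And>\<nu>. \<nu> \<in> (\<Union>\<xi>\<in>D. N \<xi>) \<Longrightarrow> (\<lambda>n. cis (2 * pi * (\<nu> \<bullet> h n))) \<longlonglongrightarrow> 1"
    using simultaneous_recurrence by metis
  have "(\<lambda>n. a (x + h n, \<xi>)) \<longlonglongrightarrow> a (x, \<xi>)" for x \<xi>
  proof (rule tendstoI)
    fix e :: real assume e: "0 < e"
    \<comment> \<open>Each of the two replacements of \<xi> by \<eta> may then cost at most e/3; the
      added 1 avoids division by zero when C is 0.\<close>
    define r where "r = e / (3 * (C + 1))"
    have r: "0 < r" using e C by (simp add: r_def)
    obtain \<eta> where \<eta>: "\<eta> \<in> D" "\<eta> \<in> ball \<xi> r"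
      using D(2)[of "ball \<xi> r"] r by auto
    have near: "norm (a (y, \<xi>) - a (y, \<eta>)) \<le> e / 3" for y
    proof -
      have "norm (a (y, \<xi>) - a (y, \<eta>)) \<le> C * norm (\<xi> - \<eta>)" by (rule C)
      also have "\<dots> \<le> (C + 1) * r"
        using C \<eta>(2) by (intro mult_mono) (auto simp: dist_norm)
      also have "\<dots> = e / 3" using C by (simp add: r_def field_simps)
      finally show ?thesis .
    qed
    have "(\<lambda>n. a (x + h n, \<eta>)) \<longlonglongrightarrow> a (x, \<eta>)"
      by (rule lim, rule h) (use \<eta> in blast)
    then have "\<forall>\<^sub>F n in sequentially. dist (a (x + h n, \<eta>)) (a (x, \<eta>)) < e / 3"
      using e by (intro tendstoD) auto
    then show "\<forall>\<^sub>F n in sequentially. dist (a (x + h n, \<xi>)) (a (x, \<xi>)) < e"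
    proof (rule eventually_mono)
      fix n assume "dist (a (x + h n, \<eta>)) (a (x, \<eta>)) < e / 3"
      then show "dist (a (x + h n, \<xi>)) (a (x, \<xi>)) < e"
        using near[of "x + h n"] near[of x]
          dist_triangle[of "a (x + h n, \<xi>)" "a (x, \<xi>)" "a (x + h n, \<eta>)"]
          dist_triangle[of "a (x + h n, \<eta>)" "a (x, \<xi>)" "a (x, \<eta>)"]
        by (simp add: dist_norm norm_minus_commute)
    qed
  qed
  with h(1) show ?thesis by (rule that)
qed

subsection \<open>The space of square-integrable functions\<close>

lemma l2_rel_self: "square_int f \<Longrightarrow> l2_rel f f"
  by (simp add: l2_rel_def)

lemma square_int_rep_l2: "square_int (rep_l2 u)"
  using Quotient3_rep_reflp[OF Quotient3_l2, of u] by (simp add: l2_rel_def)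

lemma abs_rep_l2: "abs_l2 (rep_l2 u) = u"
  by (rule Quotient3_abs_rep[OF Quotient3_l2])

lemma norm_abs_l2: "square_int f \<Longrightarrow> norm (abs_l2 f) = sqrt (LINT x|lborel. (norm (f x))\<^sup>2)"
  by (simp add: norm_l2.abs_eq l2_rel_self)

lemma inner_abs_l2:
  "square_int f \<Longrightarrow> square_int g \<Longrightarrow> abs_l2 f \<bullet> abs_l2 g = (LINT x|lborel. f x \<bullet> g x)"
  by (simp add: inner_l2.abs_eq l2_rel_self)

lemma abs_l2_add:
  "square_int f \<Longrightarrow> square_int g \<Longrightarrow> abs_l2 (\<lambda>x. f x + g x) = abs_l2 f + abs_l2 g"
  by (simp add: plus_l2.abs_eq l2_rel_self)

lemma abs_l2_diff:
  "square_int f \<Longrightarrow> square_int g \<Longrightarrow> abs_l2 (\<lambda>x. f x - g x) = abs_l2 f - abs_l2 g"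
  by (simp add: minus_l2.abs_eq l2_rel_self)

lemma square_int_dominated:
  assumes "f \<in> borel_measurable lborel" "integrable lborel (\<lambda>x. (G x)\<^sup>2)" "\<And>x. norm (f x) \<le> G x"
  shows "square_int f"
  unfolding square_int_def
proof
  show "integrable lborel (\<lambda>x. (norm (f x))\<^sup>2)"
    by (rule Bochner_Integration.integrable_bound[OF assms(2)])
      (use assms(1,3) in \<open>auto intro!: power_mono\<close>)
qed fact

lemma abs_l2_tendsto_dominated:
  assumes f: "\<And>n. f n \<in> borel_measurable lborel" "F \<in> borel_measurable lborel"
    and G: "integrable lborel (\<lambda>x. (G x)\<^sup>2)" "\<And>n x. norm (f n x) \<le> G x"
    and lim: "\<And>x. (\<lambda>n. f n x) \<longlonglongrightarrow> F x"
  shows "square_int F" "(\<lambda>n. abs_l2 (f n)) \<longlonglongrightarrow> abs_l2 F"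
proof -
  have FG: "norm (F x) \<le> G x" for x
    by (rule LIMSEQ_le_const2[OF tendsto_norm[OF lim]]) (auto simp: G)
  show F: "square_int F"
    by (rule square_int_dominated[OF f(2) G(1) FG])
  have fn: "square_int (f n)" for n
    by (rule square_int_dominated[OF f(1) G(1,2)])
  have "(\<lambda>n. LINT x|lborel. (norm (f n x - F x))\<^sup>2) \<longlonglongrightarrow> (LINT x|lborel. (norm (F x - F x))\<^sup>2)"
  \<comment> \<open>Both \<open>f n\<close> and its limit are bounded by G, so their difference is
    bounded by 2 G; squaring gives the factor 4.\<close>
  proof (rule integral_dominated_convergence[where w = "\<lambda>x. 4 * (G x)\<^sup>2"])
    show "AE x in lborel. (\<lambda>n. (norm (f n x - F x))\<^sup>2) \<longlonglongrightarrow> (norm (F x - F x))\<^sup>2"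
      by (intro AE_I2 tendsto_intros lim)
    have "(norm (f n x - F x))\<^sup>2 \<le> 4 * (G x)\<^sup>2" for n x
    proof -
      have "(norm (f n x - F x))\<^sup>2 \<le> (2 * G x)\<^sup>2"
        by (rule power_mono) (use norm_triangle_ineq4[of "f n x" "F x"] G(2)[of n x] FG[of x] in auto)
      then show ?thesis by simp
    qed
    then show "AE x in lborel. norm ((norm (f n x - F x))\<^sup>2) \<le> 4 * (G x)\<^sup>2" for n
      by simp
  qed (use f G(1) in auto)
  then have "(\<lambda>n. sqrt (LINT x|lborel. (norm (f n x - F x))\<^sup>2)) \<longlonglongrightarrow> sqrt 0"
    by (intro tendsto_real_sqrt) simp
  then have "(\<lambda>n. norm (abs_l2 (f n) - abs_l2 F)) \<longlonglongrightarrow> 0"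
    using fn F by (simp add: norm_abs_l2 square_int_diff flip: abs_l2_diff)
  then show "(\<lambda>n. abs_l2 (f n)) \<longlonglongrightarrow> abs_l2 F"
    by (simp add: tendsto_norm_zero_iff LIM_zero_iff)
qed

subsection \<open>Modulated Gaussians\<close>

text \<open>Envelope and character are both centred at h, so that changing h is an exact
  translation. The factor c is built in because T is only known to be real linear.\<close>

definition gchar :: "real^'n::finite \<Rightarrow> complex \<Rightarrow> real^'n \<Rightarrow> real^'n \<Rightarrow> complex"
  where "gchar \<nu> c h x = c * of_real (exp (- (norm (x - h))\<^sup>2 / 2)) * cis (2 * pi * (\<nu> \<bullet> (x - h)))"

text \<open>A space containing the modulated Gaussian and closed under all directional derivatives.\<close>

inductive_set poly_gchar :: "real^'n::finite \<Rightarrow> complex \<Rightarrow> real^'n \<Rightarrow> (real^'n \<Rightarrow> complex) set"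
  for \<nu> c h where
  base: "gchar \<nu> c h \<in> poly_gchar \<nu> c h"
| cmult: "g \<in> poly_gchar \<nu> c h \<Longrightarrow> (\<lambda>x. k * g x) \<in> poly_gchar \<nu> c h"
| lin: "g \<in> poly_gchar \<nu> c h \<Longrightarrow> (\<lambda>x. of_real (x \<bullet> w) * g x) \<in> poly_gchar \<nu> c h"
| add: "g \<in> poly_gchar \<nu> c h \<Longrightarrow> g' \<in> poly_gchar \<nu> c h \<Longrightarrow> (\<lambda>x. g x + g' x) \<in> poly_gchar \<nu> c h"

lemma gchar_has_derivative:
  "(gchar \<nu> c h has_derivative
     (\<lambda>v. (of_real (- (v \<bullet> (x - h))) + \<i> * of_real (2 * pi * (\<nu> \<bullet> v))) * gchar \<nu> c h x)) (at x)"
proof -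
  have eq: "gchar \<nu> c h = (\<lambda>x. c * exp (of_real (- ((x - h) \<bullet> (x - h)) / 2) + \<i> * of_real (2 * pi * (\<nu> \<bullet> (x - h)))))"
    unfolding gchar_def exp_add cis_conv_exp power2_norm_eq_inner mult.assoc exp_of_real by (rule refl)
  have "((\<lambda>x. of_real (- ((x - h) \<bullet> (x - h)) / 2) + \<i> * of_real (2 * pi * (\<nu> \<bullet> (x - h)))) has_derivative
      (\<lambda>v. of_real (- (v \<bullet> (x - h))) + \<i> * of_real (2 * pi * (\<nu> \<bullet> v)))) (at x)"
    by (auto intro!: derivative_eq_intros simp: fun_eq_iff inner_commute)
  from has_derivative_compose[OF this DERIV_exp[unfolded has_field_derivative_def]]
  show ?thesis
    unfolding eq by (rule has_derivative_mult_right[THEN has_derivative_eq_rhs])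
      (simp add: fun_eq_iff mult_ac)
qed

lemma poly_gchar_has_derivative:
  assumes "g \<in> poly_gchar \<nu> c h"
  shows "\<exists>D. (\<forall>x. (g has_derivative (\<lambda>v. D v x)) (at x)) \<and> (\<forall>v. D v \<in> poly_gchar \<nu> c h)"
  using assms
proof induction
  case base
  let ?D = "\<lambda>v x. (of_real (- (v \<bullet> (x - h))) + \<i> * of_real (2 * pi * (\<nu> \<bullet> v))) * gchar \<nu> c h x"
  \<comment> \<open>Splitting x - h separates a constant multiple from a multiple by a linear form
    in x, the two operations under which the class is closed.\<close>
  have "?D v = (\<lambda>x. (of_real (v \<bullet> h) + \<i> * of_real (2 * pi * (\<nu> \<bullet> v))) * gchar \<nu> c h x
      + of_real (x \<bullet> (- v)) * gchar \<nu> c h x)" for v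
    by (simp add: fun_eq_iff inner_diff_right inner_commute algebra_simps)
  then have "?D v \<in> poly_gchar \<nu> c h" for v
    by (simp only:) (intro poly_gchar.intros)
  then show ?case
    by (intro exI[of _ ?D] conjI allI gchar_has_derivative)
next
  case (cmult g k)
  then obtain D where "\<And>x. (g has_derivative (\<lambda>v. D v x)) (at x)" "\<And>v. D v \<in> poly_gchar \<nu> c h" by blast
  then show ?case
    by (intro exI[of _ "\<lambda>v x. k * D v x"]) (auto intro!: derivative_intros poly_gchar.intros)
next
  case (lin g w)
  then obtain D where D: "\<And>x. (g has_derivative (\<lambda>v. D v x)) (at x)" "\<And>v. D v \<in> poly_gchar \<nu> c h" by blast
  have "((\<lambda>x. of_real (x \<bullet> w) * g x) has_derivative
      (\<lambda>v. of_real (v \<bullet> w) * g x + of_real (x \<bullet> w) * D v x)) (at x)" for x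
    by (rule derivative_eq_intros D refl)+ (simp add: add.commute)
  then show ?case
    by (intro exI[of _ "\<lambda>v x. of_real (v \<bullet> w) * g x + of_real (x \<bullet> w) * D v x"])
      (use D lin in \<open>auto intro!: poly_gchar.intros\<close>)
next
  case (add g g')
  then obtain D D' where "\<And>x. (g has_derivative (\<lambda>v. D v x)) (at x)" "\<And>v. D v \<in> poly_gchar \<nu> c h"
    "\<And>x. (g' has_derivative (\<lambda>v. D' v x)) (at x)" "\<And>v. D' v \<in> poly_gchar \<nu> c h" by blast
  then show ?case
    by (intro exI[of _ "\<lambda>v x. D v x + D' v x"]) (auto intro!: derivative_intros poly_gchar.intros)
qed

lemma poly_gchar_differentiable:
  assumes "g \<in> poly_gchar \<nu> c h"
  shows "g differentiable (at x)" "(\<lambda>x. frechet_derivative g (at x) v) \<in> poly_gchar \<nu> c h"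
proof -
  obtain D where D: "\<And>x. (g has_derivative (\<lambda>v. D v x)) (at x)" "\<And>v. D v \<in> poly_gchar \<nu> c h"
    using poly_gchar_has_derivative[OF assms] by blast
  show "g differentiable (at x)" using D(1) by (auto simp: differentiable_def)
  have "frechet_derivative g (at x) = (\<lambda>v. D v x)" for x
    using frechet_derivative_at[OF D(1)] by simp
  then have "(\<lambda>x. frechet_derivative g (at x) v) = D v" by simp
  then show "(\<lambda>x. frechet_derivative g (at x) v) \<in> poly_gchar \<nu> c h" using D(2) by simp
qed

lemma poly_gchar_higher_differentiable:
  "g \<in> poly_gchar \<nu> c h \<Longrightarrow> higher_differentiable k g"
proof (induction k arbitrary: g)
  case 0
  then show ?case
    by (auto intro!: continuous_at_imp_continuous_on differentiable_imp_continuous_within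
        poly_gchar_differentiable)
next
  case (Suc k)
  then show ?case
    by (auto simp: differentiable_on_def poly_gchar_differentiable)
qed

section \<open>Decay of modulated Gaussians and membership in the Schwartz space\<close>

lemma jbracket_power_exp_le:
  fixes x h :: "'a::real_normed_vector"
  shows "\<exists>C. \<forall>x. jbracket x ^ k * exp (- (norm (x - h))\<^sup>2 / 2) \<le> C"
proof -
  \<comment> \<open>Chosen so that 1 + t + \<open>norm h\<close> is at most m (1 + t/2); the factor
    1 + t/2 is then bounded by \<open>exp (t / 2)\<close>.\<close>
  define m where "m = 2 + 2 * norm h"
  have "jbracket x ^ k * exp (- (norm (x - h))\<^sup>2 / 2) \<le> m ^ k * exp ((real k)\<^sup>2 / 8)" for x
  proof -
    define t where "t = norm (x - h)"
    have t: "0 \<le> t" by (simp add: t_def)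
    have "norm x \<le> t + norm h"
      using norm_triangle_ineq[of "x - h" h] by (simp add: t_def)
    moreover have "jbracket x \<le> 1 + norm x"
      unfolding jbracket_def by (rule real_le_lsqrt) (auto simp: power2_eq_square algebra_simps)
    moreover have "1 + (t + norm h) \<le> m * (1 + t / 2)"
      using t by (simp add: m_def algebra_simps)
    ultimately have "jbracket x \<le> m * (1 + t / 2)" by linarith
    then have "jbracket x ^ k \<le> (m * (1 + t / 2)) ^ k"
      by (rule power_mono) (simp add: jbracket_def)
    also have "\<dots> = m ^ k * (1 + t / 2) ^ k" by (simp add: power_mult_distrib)
    finally have 1: "jbracket x ^ k \<le> m ^ k * (1 + t / 2) ^ k" .
    have "(1 + t / 2) ^ k \<le> exp (t / 2) ^ k"
      using t by (intro power_mono exp_ge_add_one_self) auto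
    also have "\<dots> = exp (real k * (t / 2))" by (rule exp_of_nat_mult[symmetric])
    \<comment> \<open>Completing the square: the term linear in t is traded for the Gaussian
      exponent plus a constant.\<close>
    also have "\<dots> \<le> exp ((real k)\<^sup>2 / 8 + t\<^sup>2 / 2)"
      using zero_le_power2[of "t - real k / 2"] by (simp add: power2_eq_square algebra_simps)
    finally have "m ^ k * (1 + t / 2) ^ k \<le> m ^ k * exp ((real k)\<^sup>2 / 8 + t\<^sup>2 / 2)"
      by (rule mult_left_mono) (simp add: m_def)
    with 1 have "jbracket x ^ k \<le> m ^ k * exp ((real k)\<^sup>2 / 8 + t\<^sup>2 / 2)" by linarith
    then have "jbracket x ^ k * exp (- t\<^sup>2 / 2) \<le> m ^ k * exp ((real k)\<^sup>2 / 8 + t\<^sup>2 / 2) * exp (- t\<^sup>2 / 2)"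
      by (rule mult_right_mono) simp
    also have "\<dots> = m ^ k * exp ((real k)\<^sup>2 / 8)"
      by (simp add: mult.assoc flip: exp_add)
    finally show ?thesis by (simp add: t_def)
  qed
  then show ?thesis by blast
qed

lemma poly_gchar_decay:
  assumes "g \<in> poly_gchar \<nu> c h"
  shows "\<exists>C. \<forall>x. jbracket x ^ k * norm (g x) \<le> C"
  using assms
proof (induction arbitrary: k)
  case base
  obtain C where C: "\<And>x. jbracket x ^ k * exp (- (norm (x - h))\<^sup>2 / 2) \<le> C"
    using jbracket_power_exp_le by blast
  have "jbracket x ^ k * norm (gchar \<nu> c h x) \<le> norm c * C" for x
    using mult_left_mono[OF C[of x], of "norm c"] by (simp add: gchar_def norm_mult mult_ac)
  then show ?case by blast
next
  case (cmult g a)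
  obtain C where C: "\<And>x. jbracket x ^ k * norm (g x) \<le> C" using cmult.IH by blast
  have "jbracket x ^ k * norm (a * g x) \<le> norm a * C" for x
    using mult_left_mono[OF C[of x], of "norm a"] by (simp add: norm_mult mult_ac)
  then show ?case by blast
next
  case (lin g w)
  \<comment> \<open>One more power of the weight pays for the linear factor, which is why the
    induction leaves k arbitrary.\<close>
  obtain C where C: "\<And>x. jbracket x ^ Suc k * norm (g x) \<le> C" using lin.IH by blast
  have "jbracket x ^ k * norm (of_real (x \<bullet> w) * g x) \<le> norm w * C" for x
  proof -
    have "norm x \<le> jbracket x" by (simp add: jbracket_def real_le_rsqrt)
    then have "\<bar>x \<bullet> w\<bar> \<le> jbracket x * norm w"
      using Cauchy_Schwarz_ineq2[of x w] by (meson mult_right_mono norm_ge_zero order_trans)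
    then have "\<bar>x \<bullet> w\<bar> * (jbracket x ^ k * norm (g x)) \<le> jbracket x * norm w * (jbracket x ^ k * norm (g x))"
      by (rule mult_right_mono) (simp add: jbracket_def)
    also have "\<dots> = norm w * (jbracket x ^ Suc k * norm (g x))" by simp
    also have "\<dots> \<le> norm w * C" by (intro mult_left_mono C) simp
    finally show ?thesis by (simp add: norm_mult mult_ac)
  qed
  then show ?case by blast
next
  case (add g g')
  obtain C C' where C: "\<And>x. jbracket x ^ k * norm (g x) \<le> C" "\<And>x. jbracket x ^ k * norm (g' x) \<le> C'"
    using add.IH by metis
  have "jbracket x ^ k * norm (g x + g' x) \<le> C + C'" for x
  proof -
    have "jbracket x ^ k * norm (g x + g' x) \<le> jbracket x ^ k * (norm (g x) + norm (g' x))"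
      by (intro mult_left_mono norm_triangle_ineq) (simp add: jbracket_def)
    then show ?thesis using C[of x] by (simp add: distrib_left)
  qed
  then show ?case by blast
qed

lemma gchar_schwartz: "gchar \<nu> c h \<in> schwartz"
proof -
  have part: "partials \<alpha> (gchar \<nu> c h) \<in> poly_gchar \<nu> c h" for \<alpha>
    unfolding partials_def
    by (induction \<alpha>) (auto simp: dir_deriv_def intro: poly_gchar.base poly_gchar_differentiable)
  have "bdd_above (range (\<lambda>x. jbracket x ^ k * norm (partials \<alpha> (gchar \<nu> c h) x)))" for k \<alpha>
    using poly_gchar_decay[OF part] by (auto simp: bdd_above_def)
  moreover have "smooth (gchar \<nu> c h)"
    by (auto simp: smooth_def intro: poly_gchar_higher_differentiable poly_gchar.base)
  ultimately show ?thesis by (simp add: schwartz_def)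
qed

section \<open>Gaussian integrals in several variables, reduced to one coordinate at a time\<close>

lemma has_bochner_integral_lborel_prod:
  fixes f :: "'a::euclidean_space \<Rightarrow> real \<Rightarrow> complex"
  assumes "\<And>b. b \<in> Basis \<Longrightarrow> integrable lborel (f b)"
  shows "has_bochner_integral lborel (\<lambda>x. \<Prod>b\<in>Basis. f b (x \<bullet> b)) (\<Prod>b\<in>Basis. LINT t|lborel. f b t)"
proof -
  interpret product_sigma_finite "\<lambda>b::'a. lborel :: real measure" by standard
  have [measurable]: "f b \<in> borel_measurable borel" if "b \<in> Basis" for b
    using borel_measurable_integrable[OF assms[OF that]] by simp
  have "has_bochner_integral (\<Pi>\<^sub>M b\<in>(Basis::'a set). lborel) (\<lambda>x. \<Prod>b\<in>Basis. f b (x b))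
      (\<Prod>b\<in>Basis. LINT t|lborel. f b t)"
    using assms by (simp add: has_bochner_integral_iff product_integrable_prod product_integral_prod)
  moreover have "(\<Prod>b\<in>Basis. f b ((\<Sum>b\<in>Basis. x b *\<^sub>R b) \<bullet> b)) = (\<Prod>b\<in>Basis. f b (x b))" for x :: "'a \<Rightarrow> real"
    by (intro prod.cong) auto
  ultimately show ?thesis
    by (subst lborel_eq) (simp add: has_bochner_integral_distr)
qed

lemma power2_norm_eq_sum_Basis: "(norm x)\<^sup>2 = (\<Sum>b\<in>Basis. (x \<bullet> b)\<^sup>2)"
  for x :: "'a::euclidean_space"
  unfolding power2_norm_eq_inner by (subst euclidean_inner) (simp add: power2_eq_square)

lemma borel_measurable_cis[measurable (raw)]:
  "f \<in> borel_measurable M \<Longrightarrow> (\<lambda>x. cis (f x)) \<in> borel_measurable M"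
  by (rule borel_measurable_continuous_on[where f = cis]) (auto intro!: continuous_intros)

text \<open>This is the characteristic function of the standard normal distribution;
  \<open>sqrt (2 * pi)\<close> undoes the normalisation of its density.\<close>

lemma gaussian_has_fourier:
  "has_bochner_integral lborel (\<lambda>x::real. of_real (exp (- x\<^sup>2 / 2)) * cis (t * x))
     (of_real (sqrt (2 * pi) * exp (- t\<^sup>2 / 2)) :: complex)"
proof -
  have int: "integrable lborel (\<lambda>x. std_normal_density x *\<^sub>R cis (t * x))"
    by (rule Bochner_Integration.integrable_bound[OF integrable_normal_density[where \<mu> = 0 and \<sigma> = 1]]) auto
  have "(LINT x|lborel. std_normal_density x *\<^sub>R cis (t * x)) = char std_normal_distribution t"
    unfolding char_def by (subst integral_density) (auto simp: cis_conv_exp)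
  also have "\<dots> = of_real (exp (- t\<^sup>2 / 2))"
    by (simp add: char_std_normal_distribution)
  finally have "has_bochner_integral lborel (\<lambda>x. std_normal_density x *\<^sub>R cis (t * x)) (of_real (exp (- t\<^sup>2 / 2)))"
    using int by (simp add: has_bochner_integral_iff)
  from has_bochner_integral_scaleR_right[where c = "sqrt (2 * pi)", OF this]
  show ?thesis by (simp add: std_normal_density_def scaleR_conv_of_real)
qed

lemma gaussian_has_fourier_vec:
  fixes \<eta> :: "real^'n::finite"
  shows "has_bochner_integral lborel (\<lambda>x. of_real (exp (- (norm x)\<^sup>2 / 2)) * cis (\<eta> \<bullet> x))
     (of_real (sqrt (2 * pi) ^ CARD('n) * exp (- (norm \<eta>)\<^sup>2 / 2)))"
proof -
  have cis_sum: "cis (sum f A) = (\<Prod>a\<in>A. cis (f a))" if "finite A" for f and A :: "(real^'n) set"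
    using that by (induction A rule: finite_induct) (auto simp flip: cis_mult)
  have "has_bochner_integral lborel
      (\<lambda>x::real^'n. \<Prod>b\<in>Basis. of_real (exp (- (x \<bullet> b)\<^sup>2 / 2)) * cis ((\<eta> \<bullet> b) * (x \<bullet> b)))
      (\<Prod>b\<in>Basis. LINT s|lborel. of_real (exp (- s\<^sup>2 / 2)) * cis ((\<eta> \<bullet> b) * s))"
    using gaussian_has_fourier
    by (intro has_bochner_integral_lborel_prod) (auto simp: has_bochner_integral_iff)
  moreover have "(\<Prod>b\<in>Basis. of_real (exp (- (x \<bullet> b)\<^sup>2 / 2)) * cis ((\<eta> \<bullet> b) * (x \<bullet> b)))
      = of_real (exp (- (norm x)\<^sup>2 / 2)) * cis (\<eta> \<bullet> x)" for x :: "real^'n"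
    by (simp add: prod.distrib power2_norm_eq_sum_Basis euclidean_inner[of \<eta> x] cis_sum exp_sum sum_divide_distrib flip: sum_negf)
  moreover have "(\<Prod>b\<in>(Basis::(real^'n) set). LINT s|lborel. of_real (exp (- s\<^sup>2 / 2)) * cis ((\<eta> \<bullet> b) * s))
      = (\<Prod>b\<in>(Basis::(real^'n) set). of_real (sqrt (2 * pi) * exp (- (\<eta> \<bullet> b)\<^sup>2 / 2)))"
    by (intro prod.cong refl has_bochner_integral_integral_eq gaussian_has_fourier)
  moreover have "\<dots> = of_real (sqrt (2 * pi) ^ CARD('n) * exp (- (norm \<eta>)\<^sup>2 / 2))"
    by (simp add: prod.distrib power2_norm_eq_sum_Basis exp_sum sum_divide_distrib flip: sum_negf)
  ultimately show ?thesis by simp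
qed

lemma integrable_gaussian:
  assumes "0 < s"
  shows "integrable lborel (\<lambda>x::real^'n::finite. exp (- s * (norm (x - y))\<^sup>2))"
proof -
  \<comment> \<open>The standard deviation for which the exponent of the normal density has
    coefficient s.\<close>
  define \<sigma> where "\<sigma> = sqrt (1 / (2 * s))"
  have \<sigma>: "0 < \<sigma>" "1 / (2 * \<sigma>\<^sup>2) = s" using assms by (auto simp: \<sigma>_def)
  have "integrable lborel (\<lambda>t. sqrt (2 * pi * \<sigma>\<^sup>2) * normal_density m \<sigma> t)" for m
    using \<sigma> by (intro Bochner_Integration.integrable_mult_right integrable_normal_density)
  moreover have "sqrt (2 * pi * \<sigma>\<^sup>2) * normal_density m \<sigma> t = exp (- s * (t - m)\<^sup>2)" for m t
    using \<sigma> by (simp add: normal_density_def flip: \<sigma>(2))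
  ultimately have "integrable lborel (\<lambda>t. exp (- s * (t - m)\<^sup>2))" for m :: real
    by simp
  then have "integrable lborel (\<lambda>t. complex_of_real (exp (- s * (t - m)\<^sup>2)))" for m :: real
    by (simp only: complex_of_real_integrable_eq)
  then have "has_bochner_integral lborel
      (\<lambda>x::real^'n. \<Prod>b\<in>Basis. complex_of_real (exp (- s * (x \<bullet> b - y \<bullet> b)\<^sup>2)))
      (\<Prod>b\<in>(Basis::(real^'n) set). LINT t|lborel. complex_of_real (exp (- s * (t - y \<bullet> b)\<^sup>2)))"
    by (intro has_bochner_integral_lborel_prod)
  then have "integrable lborel (\<lambda>x::real^'n. complex_of_real (\<Prod>b\<in>Basis. exp (- s * (x \<bullet> b - y \<bullet> b)\<^sup>2)))"
    by (simp add: has_bochner_integral_iff)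
  moreover have "(\<Prod>b\<in>Basis. exp (- s * (x \<bullet> b - y \<bullet> b)\<^sup>2)) = exp (- s * (norm (x - y))\<^sup>2)" for x :: "real^'n"
    by (simp add: power2_norm_eq_sum_Basis inner_diff_left exp_sum sum_distrib_left flip: sum_negf)
  ultimately show ?thesis by (simp only: complex_of_real_integrable_eq)
qed

subsection \<open>Density of modulated Gaussians\<close>

text \<open>Dividing by the Gaussian turns dominated limits into bounded ones and makes constants admissible.\<close>

definition gaussian_null :: "('n l2 \<Rightarrow> 'n l2) \<Rightarrow> (real^'n::finite \<Rightarrow> complex) set"
  where "gaussian_null T = {P. P \<in> borel_measurable borel \<and> (\<exists>B. \<forall>x. norm (P x) \<le> B) \<and>
    T (abs_l2 (\<lambda>x. of_real (exp (- (norm x)\<^sup>2 / 2)) * P x)) = 0}"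

text \<open>Trigonometric polynomials again, now generated inductively, so that closure under
  products and membership in \<open>gaussian_null T\<close> go by induction. Frequencies are
  unscaled here; the factor \<open>2 * pi\<close> is restored on the way back to
  \<open>gchar\<close>.\<close>

inductive_set trig :: "(real^'n::finite \<Rightarrow> complex) set" where
  char: "(\<lambda>x. c * cis (\<eta> \<bullet> x)) \<in> trig"
| add: "p \<in> trig \<Longrightarrow> q \<in> trig \<Longrightarrow> (\<lambda>x. p x + q x) \<in> trig"

lemma trig_const: "(\<lambda>x. c) \<in> trig"
  using trig.char[of c 0] by simp

lemma trig_mult: "p \<in> trig \<Longrightarrow> q \<in> trig \<Longrightarrow> (\<lambda>x. p x * q x) \<in> trig"
proof (induction rule: trig.induct)
  case (char c \<eta>)
  from char show ?case
  proof (induction rule: trig.induct)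
    case (char c' \<eta>')
    have "(\<lambda>x. c * cis (\<eta> \<bullet> x) * (c' * cis (\<eta>' \<bullet> x))) = (\<lambda>x. (c * c') * cis ((\<eta> + \<eta>') \<bullet> x))"
      by (simp add: fun_eq_iff inner_add_left mult_ac flip: cis_mult)
    then show ?case by (simp add: trig.char)
  next
    case (add p q)
    from trig.add[OF add.IH] show ?case by (simp only: distrib_left)
  qed
next
  case (add p q')
  from trig.add[OF add.IH] show ?case using add.prems by (simp only: distrib_right)
qed

lemma trig_sum: "finite I \<Longrightarrow> (\<And>i. i \<in> I \<Longrightarrow> p i \<in> trig) \<Longrightarrow> (\<lambda>x. \<Sum>i\<in>I. p i x) \<in> trig"
  by (induction I rule: finite_induct) (auto intro: trig_const trig.add)

lemma trig_sin: "(\<lambda>x. complex_of_real (sin (\<eta> \<bullet> x))) \<in> trig"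
proof -
  have "(\<lambda>x. complex_of_real (sin (\<eta> \<bullet> x))) =
      (\<lambda>x. - \<i> / 2 * cis (\<eta> \<bullet> x) + \<i> / 2 * cis ((- \<eta>) \<bullet> x))"
    by (auto simp: fun_eq_iff complex_eq_iff)
  then show ?thesis by (simp only:) (intro trig.add trig.char)
qed

lemma trig_polynomial:
  fixes p :: "real^'n::finite \<Rightarrow> real"
  assumes "real_polynomial_function p"
  shows "(\<lambda>x. complex_of_real (p (\<chi> i. L * sin (x $ i / L)))) \<in> trig"
  using assms
proof induction
  case (linear f)
  then interpret f: bounded_linear f .
  \<comment> \<open>The base case concerns an arbitrary linear functional, and only its coordinates
    become sines.\<close>
  have expand: "f y = (\<Sum>i\<in>UNIV. y $ i * f (axis i 1))" for y
  proof -
    have "f y = f (\<Sum>i\<in>UNIV. (y $ i) *\<^sub>R axis i 1)"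
      using basis_expansion[of y] by (simp add: scalar_mult_eq_scaleR)
    then show ?thesis by (simp add: f.sum f.scaleR)
  qed
  have "(\<lambda>x. complex_of_real (f (\<chi> i. L * sin (x $ i / L))))
      = (\<lambda>x. \<Sum>i\<in>UNIV. complex_of_real (L * f (axis i 1)) * complex_of_real (sin (axis i (1 / L) \<bullet> x)))"
    by (rule ext, subst expand) (simp add: inner_axis' mult_ac)
  then show ?case by (simp only:) (intro trig_sum trig_mult trig_const trig_sin; simp)
next
  case (const c)
  then show ?case by (rule trig_const)
next
  case (add f g)
  then show ?case using trig.add[OF add.IH] by simp
next
  case (mult f g)
  then show ?case using trig_mult[OF mult.IH] by simp
qed

lemma square_int_gaussian_mult:
  fixes P :: "real^'n::finite \<Rightarrow> complex"
  assumes "P \<in> borel_measurable borel" "\<And>x. norm (P x) \<le> B"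
  shows "square_int (\<lambda>x. of_real (exp (- (norm x)\<^sup>2 / 2)) * P x)"
    "integrable lborel (\<lambda>x::real^'n. (exp (- (norm x)\<^sup>2 / 2) * B)\<^sup>2)"
proof -
  have "(exp (- (norm x)\<^sup>2 / 2) * B)\<^sup>2 = B\<^sup>2 * exp (- 1 * (norm (x - 0))\<^sup>2)" for x :: "real^'n"
    by (simp add: power2_eq_square mult_ac flip: exp_add)
  then show int: "integrable lborel (\<lambda>x::real^'n. (exp (- (norm x)\<^sup>2 / 2) * B)\<^sup>2)"
    using integrable_gaussian[of 1 "0::real^'n"] by (simp only:) (rule integrable_mult_right, simp)
  show "square_int (\<lambda>x. of_real (exp (- (norm x)\<^sup>2 / 2)) * P x)"
    by (rule square_int_dominated[OF _ int])
      (use assms in \<open>auto simp: norm_mult intro!: mult_left_mono\<close>)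
qed

section \<open>From Gaussians times characters to all of L2\<close>

context
  fixes T :: "'n::finite l2 \<Rightarrow> 'n l2"
  assumes T: "bounded_linear T"
    and gchar0: "\<And>\<nu> c. T (abs_l2 (gchar \<nu> c 0)) = 0"
begin

interpretation T: bounded_linear T by (rule T)

lemma gaussian_null_add:
  assumes "P \<in> gaussian_null T" "Q \<in> gaussian_null T"
  shows "(\<lambda>x. P x + Q x) \<in> gaussian_null T"
proof -
  obtain B B' where P: "P \<in> borel_measurable borel" "\<And>x. norm (P x) \<le> B"
    and Q: "Q \<in> borel_measurable borel" "\<And>x. norm (Q x) \<le> B'"
    using assms unfolding gaussian_null_def by auto
  have "norm (P x + Q x) \<le> B + B'" for x
    using norm_triangle_mono P(2) Q(2) by blast
  moreover have "abs_l2 (\<lambda>x. of_real (exp (- (norm x)\<^sup>2 / 2)) * (P x + Q x))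
      = abs_l2 (\<lambda>x. of_real (exp (- (norm x)\<^sup>2 / 2)) * P x) + abs_l2 (\<lambda>x. of_real (exp (- (norm x)\<^sup>2 / 2)) * Q x)"
    unfolding distrib_left
    by (intro abs_l2_add square_int_gaussian_mult(1)[OF P] square_int_gaussian_mult(1)[OF Q])
  ultimately show ?thesis
    using assms unfolding gaussian_null_def by (auto simp: T.add)
qed

text \<open>Times the Gaussian, the constant B becomes a square-integrable majorant, so bounded
  pointwise convergence yields L2 convergence, and the kernel of T is closed.\<close>

lemma gaussian_null_lim:
  assumes P: "\<And>n. P n \<in> gaussian_null T" and B: "\<And>n x. norm (P n x) \<le> B"
    and lim: "\<And>x. (\<lambda>n. P n x) \<longlonglongrightarrow> Q x"
  shows "Q \<in> gaussian_null T"
proof -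
  have Pm: "P n \<in> borel_measurable borel" for n
    using P by (simp add: gaussian_null_def)
  have Qm: "Q \<in> borel_measurable borel"
    by (rule borel_measurable_LIMSEQ_metric[OF Pm]) (use lim in simp)
  have QB: "norm (Q x) \<le> B" for x
    by (rule LIMSEQ_le_const2[OF tendsto_norm[OF lim]]) (auto simp: B)
  have "(\<lambda>n. abs_l2 (\<lambda>x. of_real (exp (- (norm x)\<^sup>2 / 2)) * P n x)) \<longlonglongrightarrow>
      abs_l2 (\<lambda>x. of_real (exp (- (norm x)\<^sup>2 / 2)) * Q x)"
    by (rule abs_l2_tendsto_dominated(2)[OF _ _ square_int_gaussian_mult(2)[OF Qm QB]])
      (use Pm Qm B in \<open>auto simp: norm_mult intro!: mult_left_mono tendsto_intros lim\<close>)
  from T.tendsto[OF this]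
  have "(\<lambda>n. 0) \<longlonglongrightarrow> T (abs_l2 (\<lambda>x. of_real (exp (- (norm x)\<^sup>2 / 2)) * Q x))"
    using P by (simp add: gaussian_null_def)
  then have "T (abs_l2 (\<lambda>x. of_real (exp (- (norm x)\<^sup>2 / 2)) * Q x)) = 0"
    by (simp add: LIMSEQ_const_iff)
  then show ?thesis using Qm QB by (auto simp: gaussian_null_def)
qed

lemma gaussian_null_trig: "p \<in> trig \<Longrightarrow> p \<in> gaussian_null T"
proof (induction rule: trig.induct)
  case (char c \<eta>)
  have "2 * pi * ((\<eta> /\<^sub>R (2 * pi)) \<bullet> x) = \<eta> \<bullet> x" for x
    by (simp add: field_simps)
  then have "(\<lambda>x. of_real (exp (- (norm x)\<^sup>2 / 2)) * (c * cis (\<eta> \<bullet> x))) = gchar (\<eta> /\<^sub>R (2 * pi)) c 0"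
    unfolding gchar_def by (simp only: diff_zero mult_ac)
  moreover have "norm (c * cis (\<eta> \<bullet> x)) \<le> norm c" for x
    by (simp add: norm_mult)
  ultimately show ?case
    by (auto simp: gaussian_null_def gchar0)
qed (rule gaussian_null_add)

lemma gaussian_null_const: "(\<lambda>x. c) \<in> gaussian_null T"
  by (intro gaussian_null_trig trig_const)

lemma gaussian_null_sum:
  "finite I \<Longrightarrow> (\<And>i. i \<in> I \<Longrightarrow> p i \<in> gaussian_null T) \<Longrightarrow> (\<lambda>x. \<Sum>i\<in>I. p i x) \<in> gaussian_null T"
  by (induction I rule: finite_induct) (auto intro: gaussian_null_const gaussian_null_add)

text \<open>
  The map \<open>x \<mapsto> (L sin (x\<^sub>i / L))\<^sub>i\<close> has values in a cube, where \<open>F\<close> is approximated by polynomials, and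
  polynomials in it are trigonometric polynomials; it tends to the identity as \<open>L \<rightarrow> \<infinity>\<close>.
\<close>

lemma gaussian_null_continuous:
  fixes F :: "real^'n \<Rightarrow> real"
  assumes F: "continuous_on UNIV F" and B: "\<And>x. \<bar>F x\<bar> \<le> B"
  shows "(\<lambda>x. k * complex_of_real (F x)) \<in> gaussian_null T"
proof (rule gaussian_null_lim)
  define u :: "real \<Rightarrow> real^'n \<Rightarrow> real^'n" where "u L x = (\<chi> i. L * sin (x $ i / L))" for L x
  show "(\<lambda>x. k * complex_of_real (F (u (real (Suc n)) x))) \<in> gaussian_null T" for n
  proof -
    \<comment> \<open>The successor keeps L positive, since L also occurs as a divisor.\<close>
    define L where "L = real (Suc n)"
    define S :: "(real^'n) set" where "S = cbox (\<chi> i. - L) (\<chi> i. L)"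
    have u: "u L x \<in> S" for x
      unfolding S_def mem_box_cart u_def
      using mult_left_mono[OF sin_le_one, of L] mult_left_mono[OF sin_ge_minus_one, of L]
      by (simp add: L_def)
    have "\<exists>p. real_polynomial_function p \<and> (\<forall>y\<in>S. \<bar>F y - p y\<bar> < 1 / real (Suc m))" for m
      using Stone_Weierstrass_real_polynomial_function[of S F "1 / real (Suc m)"] F
      by (metis S_def compact_cbox continuous_on_subset of_nat_0_less_iff subset_UNIV zero_less_Suc zero_less_divide_1_iff)
    then obtain p where p: "\<And>m. real_polynomial_function (p m)"
      and close: "\<And>m y. y \<in> S \<Longrightarrow> \<bar>F y - p m y\<bar> < 1 / real (Suc m)" by metis
    show ?thesis
    proof (rule gaussian_null_lim)
      show "(\<lambda>x. k * complex_of_real (p m (u L x))) \<in> gaussian_null T" for m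
        unfolding u_def by (intro gaussian_null_trig trig_mult trig_const trig_polynomial p)
      \<comment> \<open>The polynomials are evaluated only on the cube \<open>S\<close>, where they
        are within 1 of F; hence a bound uniform in m and x.\<close>
      show "norm (k * complex_of_real (p m (u L x))) \<le> norm k * (B + 1)" for m x
      proof -
        have "1 / real (Suc m) \<le> 1" by simp
        then have "\<bar>p m (u L x)\<bar> \<le> B + 1"
          using close[OF u, of x m] B[of "u L x"] by linarith
        then show ?thesis by (simp add: norm_mult mult_left_mono)
      qed
      show "(\<lambda>m. k * complex_of_real (p m (u L x))) \<longlonglongrightarrow> k * complex_of_real (F (u (real (Suc n)) x))" for x
      proof -
        have "(\<lambda>m. p m (u L x)) \<longlonglongrightarrow> F (u L x)"
        proof (rule LIMSEQ_I)
          fix e :: real assume "0 < e"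
          then obtain M where M: "inverse (real (Suc M)) < e" using reals_Archimedean by blast
          have "norm (p m (u L x) - F (u L x)) < e" if "M \<le> m" for m
          proof -
            have "1 / real (Suc m) \<le> inverse (real (Suc M))" using that by (simp add: divide_simps)
            then show ?thesis using close[OF u, of x m] M by simp
          qed
          then show "\<exists>M. \<forall>m\<ge>M. norm (p m (u L x) - F (u L x)) < e" by blast
        qed
        then show ?thesis unfolding L_def[symmetric] by (intro tendsto_intros)
      qed
    qed
  qed
  show "norm (k * complex_of_real (F (u (real (Suc n)) x))) \<le> norm k * B" for n x
    by (simp add: norm_mult mult_left_mono B)
  show "(\<lambda>n. k * complex_of_real (F (u (real (Suc n)) x))) \<longlonglongrightarrow> k * complex_of_real (F x)" for x
  proof -
    have "(\<lambda>n. real (Suc n) * sin (t / real (Suc n))) \<longlonglongrightarrow> t" for t :: real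
      by real_asymp
    then have "(\<lambda>n. u (real (Suc n)) x) \<longlonglongrightarrow> x"
      unfolding u_def by (intro vec_tendstoI) (simp del: of_nat_Suc)
    then have "(\<lambda>n. F (u (real (Suc n)) x)) \<longlonglongrightarrow> F x"
      using F by (simp add: continuous_on_tendsto_compose[OF F])
    then show ?thesis by (intro tendsto_intros)
  qed
qed

lemma gaussian_null_open:
  assumes "open U"
  shows "(\<lambda>x. k * indicator U x) \<in> gaussian_null T"
\<comment> \<open>The whole space is separate because its complement is empty and
  \<open>infdist\<close> to the empty set is 0, so the cut-offs used below would all vanish.\<close>
proof (cases "U = UNIV")
  case True
  then show ?thesis using gaussian_null_const[of k] by simp
next
  case False
  have "(\<lambda>x. k * complex_of_real (indicator U x)) \<in> gaussian_null T"
  proof (rule gaussian_null_lim)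
    show "(\<lambda>x. k * complex_of_real (min 1 (real n * infdist x (- U)))) \<in> gaussian_null T" for n
      by (rule gaussian_null_continuous[where B = 1])
        (auto intro!: continuous_intros simp: infdist_nonneg abs_le_iff)
    show "norm (k * complex_of_real (min 1 (real n * infdist x (- U)))) \<le> norm k * 1" for n x
      unfolding norm_mult by (rule mult_left_mono) (auto simp: infdist_nonneg abs_le_iff)
    show "(\<lambda>n. k * complex_of_real (min 1 (real n * infdist x (- U)))) \<longlonglongrightarrow> k * complex_of_real (indicator U x)" for x
    proof (cases "x \<in> U")
      case True
      then have pos: "0 < infdist x (- U)"
        using assms False in_closed_iff_infdist_zero[of "- U" x] infdist_nonneg[of x "- U"]
        by (auto simp: closed_Compl less_le)
      then obtain N :: nat where N: "1 < real N * infdist x (- U)"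
        using reals_Archimedean3 by blast
      have "\<forall>\<^sub>F n in sequentially. min 1 (real n * infdist x (- U)) = 1"
        using eventually_ge_at_top[of N]
      proof eventually_elim
        case (elim n)
        then have "real N * infdist x (- U) \<le> real n * infdist x (- U)"
          using pos by (intro mult_right_mono) auto
        with N show ?case by simp
      qed
      then show ?thesis
        using True by (intro tendsto_intros tendsto_eventually) simp
    next
      case False
      then show ?thesis by simp
    qed
  qed
  moreover have "complex_of_real (indicator U x) = indicator U x" for x
    by (simp add: indicator_def)
  ultimately show ?thesis by simp
qed

text \<open>Dynkin's argument: open sets form an intersection-stable generator. Disjointness is
  essential in the union step, as it makes the partial sums multiples of indicators and so uniformly
  bounded.\<close>

lemma gaussian_null_borel:
  assumes "A \<in> sets borel"
  shows "(\<lambda>x. k * indicator A x) \<in> gaussian_null T"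
proof -
  have "Int_stable {S :: (real^'n) set. open S}" by (auto simp: Int_stable_def)
  moreover have "{S :: (real^'n) set. open S} \<subseteq> Pow UNIV" by simp
  moreover have "A \<in> sigma_sets UNIV {S. open S}"
    using assms by (simp add: borel_def)
  ultimately show ?thesis
  proof (induction arbitrary: k rule: sigma_sets_induct_disjoint)
    case (basic A)
    then show ?case by (simp add: gaussian_null_open)
  next
    case empty
    then show ?case using gaussian_null_const[of 0] by simp
  next
    case (compl A)
    have eq: "(\<lambda>x. k * indicator (UNIV - A) x) = (\<lambda>x. k + (- k) * indicator A x)"
      by (auto simp: fun_eq_iff indicator_def)
    show ?case unfolding eq by (rule gaussian_null_add[OF gaussian_null_const compl(2)])
  next
    case (union A)
    have eq: "(\<Sum>i<n. k * indicator (A i) x) = k * indicator (\<Union>i<n. A i) x" for n x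
      using union(1) by (subst indicator_UN_disjoint) 
        (auto simp: sum_distrib_left intro: disjoint_family_on_mono)
    show ?case
    proof (rule gaussian_null_lim)
      show "(\<lambda>x. \<Sum>i<n. k * indicator (A i) x) \<in> gaussian_null T" for n
        by (rule gaussian_null_sum) (auto intro: union)
      show "norm (\<Sum>i<n. k * indicator (A i) x) \<le> norm k" for n x
        unfolding eq by (simp add: indicator_def)
      show "(\<lambda>n. \<Sum>i<n. k * indicator (A i) x) \<longlonglongrightarrow> k * indicator (\<Union>i. A i) x" for x
        unfolding eq by (intro tendsto_intros LIMSEQ_indicator_UN)
    qed
  qed
qed

lemma gaussian_null_bounded:
  assumes P: "P \<in> borel_measurable borel" and B: "\<And>x. norm (P x) \<le> B"
  shows "P \<in> gaussian_null T"
proof -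
  obtain F where F: "\<And>i. simple_function borel (F i)" "\<And>x. (\<lambda>i. F i x) \<longlonglongrightarrow> P x"
    "\<And>i x. norm (F i x) \<le> 2 * norm (P x)"
    using borel_measurable_implies_sequence_metric[OF P, of 0] by auto
  show ?thesis
  proof (rule gaussian_null_lim[OF _ _ F(2)])
    show "norm (F i x) \<le> 2 * B" for i x using F(3)[of i x] B[of x] by linarith
    show "F i \<in> gaussian_null T" for i
    proof -
      have fin: "finite (range (F i))"
        using F(1)[of i] by (simp add: simple_function_def)
      have meas: "F i -` {c} \<in> sets borel" for c
        using measurable_sets[OF borel_measurable_simple_function[OF F(1)[of i]], of "{c}"] by simp
      have "F i = (\<lambda>x. \<Sum>c\<in>range (F i). c * indicator (F i -` {c}) x)"
        using fin by (auto simp: fun_eq_iff indicator_def sum.delta if_distrib cong: if_cong)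
      moreover have "(\<lambda>x. \<Sum>c\<in>range (F i). c * indicator (F i -` {c}) x) \<in> gaussian_null T"
        by (intro gaussian_null_sum fin gaussian_null_borel meas)
      ultimately show ?thesis by simp
    qed
  qed
qed

text \<open>Cutting f off where it exceeds n times the Gaussian \<open>w\<close>, instead of n,
  makes the quotient by \<open>w\<close> bounded. Multiplying back gives truncations of f that
  converge to f and are dominated by |f|.\<close>

lemma eq_0_if_gchar_null: "T u = 0"
proof -
  define f where "f = rep_l2 u"
  have f: "square_int f" and u: "u = abs_l2 f"
    by (simp_all add: f_def square_int_rep_l2 abs_rep_l2)
  then have fm [measurable]: "f \<in> borel_measurable borel" by (simp add: square_int_def)
  define w where "w x = exp (- (norm x)\<^sup>2 / 2)" for x :: "real^'n"
  have w: "0 < w x" for x by (simp add: w_def)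
  have [measurable]: "w \<in> borel_measurable borel" by (simp add: w_def[abs_def])
  define P where "P n x = (if norm (f x) \<le> real n * w x then f x / of_real (w x) else 0)" for n x
  have "P n \<in> gaussian_null T" for n
  proof (rule gaussian_null_bounded)
    show "P n \<in> borel_measurable borel" by (simp add: P_def[abs_def])
    show "norm (P n x) \<le> real n" for x
      using w[of x] by (simp add: P_def norm_divide divide_simps)
  qed
  then have T0: "T (abs_l2 (\<lambda>x. of_real (w x) * P n x)) = 0" for n
    by (simp add: gaussian_null_def w_def)
  have "(\<lambda>n. abs_l2 (\<lambda>x. of_real (w x) * P n x)) \<longlonglongrightarrow> abs_l2 f"
  proof (rule abs_l2_tendsto_dominated(2))
    show "integrable lborel (\<lambda>x. (norm (f x))\<^sup>2)" using f by (simp add: square_int_def)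
    show "norm (of_real (w x) * P n x) \<le> norm (f x)" for n x
      using w[of x] by (simp add: P_def norm_mult norm_divide)
    show "(\<lambda>n. of_real (w x) * P n x) \<longlonglongrightarrow> f x" for x
    proof (rule tendsto_eventually)
      obtain N :: nat where N: "norm (f x) < real N * w x"
        using reals_Archimedean3[OF w] by blast
      show "\<forall>\<^sub>F n in sequentially. of_real (w x) * P n x = f x"
        using eventually_ge_at_top[of N]
      proof eventually_elim
        case (elim n)
        then have "real N * w x \<le> real n * w x"
          using w[of x] by (intro mult_right_mono) auto
        with N have "norm (f x) \<le> real n * w x" by simp
        then show ?case using w[of x] by (simp add: P_def)
      qed
    qed
  qed (simp_all add: P_def[abs_def])
  from T.tendsto[OF this] show ?thesis
    by (simp add: T0 u LIMSEQ_const_iff)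
qed

end

subsection \<open>Translates of modulated Gaussians\<close>

lemma AE_lborel_translate:
  fixes h :: "'a::euclidean_space"
  assumes "AE x in lborel. P x"
  shows "AE x in lborel. P (x + h)"
proof -
  have "AE x in distr lborel borel ((+) h). P x"
    unfolding lborel_distr_plus by (rule assms)
  then have "AE x in lborel. P (h + x)"
    by (rule AE_distrD[rotated]) simp
  then show ?thesis by (simp add: add.commute)
qed

lemma lborel_integral_translate:
  fixes h :: "'a::euclidean_space" and f :: "'a \<Rightarrow> 'b::{banach, second_countable_topology}"
  assumes "f \<in> borel_measurable borel"
  shows "(LINT x|lborel. f (x + h)) = (LINT x|lborel. f x)"
proof -
  have "(LINT x|lborel. f x) = (LINT x|distr lborel borel ((+) h). f x)"
    by (simp add: lborel_distr_plus)
  also have "\<dots> = (LINT x|lborel. f (h + x))"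
    using assms by (intro integral_distr) auto
  finally show ?thesis by (simp add: add.commute)
qed

lemma nn_integral_lborel_translate:
  fixes h :: "'a::euclidean_space"
  assumes "f \<in> borel_measurable borel"
  shows "(\<integral>\<^sup>+ x. f (x + h) \<partial>lborel) = (\<integral>\<^sup>+ x. f x \<partial>lborel)"
proof -
  have "(\<integral>\<^sup>+ x. f x \<partial>lborel) = (\<integral>\<^sup>+ x. f x \<partial>distr lborel borel ((+) h))"
    by (simp add: lborel_distr_plus)
  also have "\<dots> = (\<integral>\<^sup>+ x. f (h + x) \<partial>lborel)"
    using assms by (intro nn_integral_distr) auto
  finally show ?thesis by (simp add: add.commute)
qed

lemma nn_integral_rep_l2: "(\<integral>\<^sup>+ x. ennreal ((norm (rep_l2 v x))\<^sup>2) \<partial>lborel) = ennreal ((norm v)\<^sup>2)"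
proof -
  have sq: "square_int (rep_l2 v)" by (rule square_int_rep_l2)
  have "norm v = sqrt (LINT x|lborel. (norm (rep_l2 v x))\<^sup>2)"
    using norm_abs_l2[OF sq] by (simp add: abs_rep_l2)
  then have "(norm v)\<^sup>2 = (LINT x|lborel. (norm (rep_l2 v x))\<^sup>2)"
    by simp
  then show ?thesis
    using sq by (subst nn_integral_eq_integral) (auto simp: square_int_def)
qed

lemma gchar_measurable [measurable]: "gchar \<nu> c h \<in> borel_measurable borel"
  unfolding gchar_def[abs_def] by measurable

lemma norm_gchar: "norm (gchar \<nu> c h x) = norm c * exp (- (norm (x - h))\<^sup>2 / 2)"
  by (simp add: gchar_def norm_mult)

lemma gchar_integrable: "integrable lborel (gchar \<nu> c h)"
proof (rule Bochner_Integration.integrable_bound)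
  show "integrable lborel (\<lambda>x. norm c * exp (- (1 / 2) * (norm (x - h))\<^sup>2))"
    by (intro Bochner_Integration.integrable_mult_right integrable_gaussian) simp
qed (auto simp: norm_gchar)

lemma square_int_gchar: "square_int (gchar \<nu> c h)"
  unfolding square_int_def
proof
  have "(norm (gchar \<nu> c h x))\<^sup>2 = (norm c)\<^sup>2 * exp (- 1 * (norm (x - h))\<^sup>2)" for x
    by (simp add: norm_gchar power_mult_distrib flip: exp_of_nat_mult)
  then show "integrable lborel (\<lambda>x. (norm (gchar \<nu> c h x))\<^sup>2)"
    by (simp only:) (intro Bochner_Integration.integrable_mult_right integrable_gaussian, simp)
qed simp

lemma norm_abs_l2_gchar: "norm (abs_l2 (gchar \<nu> c h)) = norm (abs_l2 (gchar \<nu> c 0))"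
proof -
  have "(LINT x|lborel. (norm (gchar \<nu> c h x))\<^sup>2) = (LINT x|lborel. (norm (gchar \<nu> c h (x + h)))\<^sup>2)"
    by (rule lborel_integral_translate[symmetric]) simp
  also have "\<dots> = (LINT x|lborel. (norm (gchar \<nu> c 0 x))\<^sup>2)"
    by (simp add: norm_gchar)
  finally show ?thesis by (simp add: norm_abs_l2 square_int_gchar)
qed

text \<open>The moving factor is bounded by \<open>norm c\<close> and tends to 0 at every point,
  while the fixed one is integrable.\<close>

lemma gchar_translates_weakly_null:
  assumes h: "filterlim (\<lambda>n. norm (h n)) at_top sequentially"
  shows "(\<lambda>m. abs_l2 (gchar \<nu> c k) \<bullet> abs_l2 (gchar \<nu> c (h m))) \<longlonglongrightarrow> 0"
proof -
  have le: "norm (gchar \<nu> c y x) \<le> norm c" for x y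
    by (simp add: norm_gchar mult_left_le)
  have lim: "(\<lambda>m. gchar \<nu> c (h m) x) \<longlonglongrightarrow> 0" for x
  proof -
    have "filterlim (\<lambda>m. norm (h m) + (- norm x)) at_top sequentially"
      using filterlim_tendsto_add_at_top[OF tendsto_const[of "- norm x"] h] by (simp add: add.commute)
    then have far: "filterlim (\<lambda>m. norm (x - h m)) at_top sequentially"
    proof (rule filterlim_at_top_mono)
      show "\<forall>\<^sub>F m in sequentially. norm (h m) + (- norm x) \<le> norm (x - h m)"
        using norm_triangle_ineq2[of "h m" x for m] by (simp add: norm_minus_commute)
    qed
    have "((\<lambda>t::real. norm c * exp (- t\<^sup>2 / 2)) \<longlongrightarrow> norm c * 0) at_top"
      by (intro tendsto_mult tendsto_const) real_asymp
    from filterlim_compose[OF this far]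
    have "(\<lambda>m. norm (gchar \<nu> c (h m) x)) \<longlonglongrightarrow> 0" by (simp add: norm_gchar)
    then show ?thesis by (rule tendsto_norm_zero_cancel)
  qed
  have "(\<lambda>m. LINT x|lborel. gchar \<nu> c k x \<bullet> gchar \<nu> c (h m) x) \<longlonglongrightarrow> (LINT x|lborel. gchar \<nu> c k x \<bullet> 0)"
  proof (rule integral_dominated_convergence[where w = "\<lambda>x. norm (gchar \<nu> c k x) * norm c"])
    show "integrable lborel (\<lambda>x. norm (gchar \<nu> c k x) * norm c)"
      by (intro Bochner_Integration.integrable_mult_left integrable_norm gchar_integrable)
    show "AE x in lborel. (\<lambda>m. gchar \<nu> c k x \<bullet> gchar \<nu> c (h m) x) \<longlonglongrightarrow> gchar \<nu> c k x \<bullet> 0"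
      by (intro AE_I2 tendsto_intros lim)
    show "AE x in lborel. norm (gchar \<nu> c k x \<bullet> gchar \<nu> c (h m) x) \<le> norm (gchar \<nu> c k x) * norm c" for m
    proof (rule AE_I2)
      fix x
      show "norm (gchar \<nu> c k x \<bullet> gchar \<nu> c (h m) x) \<le> norm (gchar \<nu> c k x) * norm c"
        using Cauchy_Schwarz_ineq2[of "gchar \<nu> c k x" "gchar \<nu> c (h m) x"]
          mult_left_mono[OF le[of "h m" x], of "norm (gchar \<nu> c k x)"] by simp
    qed
  qed simp_all
  then show ?thesis by (simp add: inner_abs_l2 square_int_gchar)
qed

lemma fourier_gchar:
  fixes \<nu> :: "real^'n::finite"
  shows "fourier (gchar \<nu> c h) \<xi> = cis (- (2 * pi * (h \<bullet> \<xi>))) *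
    (c * of_real (sqrt (2 * pi) ^ CARD('n) * exp (- (2 * pi\<^sup>2) * (norm (\<xi> - \<nu>))\<^sup>2)))"
proof -
  have "fourier (gchar \<nu> c h) \<xi> = (LINT x|lborel. gchar \<nu> c h (x + h) * cis (- (2 * pi * ((x + h) \<bullet> \<xi>))))"
    unfolding fourier_def by (rule lborel_integral_translate[symmetric]) simp
  also have "\<dots> = (LINT x|lborel. (cis (- (2 * pi * (h \<bullet> \<xi>))) * c) *
      (of_real (exp (- (norm x)\<^sup>2 / 2)) * cis (((2 * pi) *\<^sub>R (\<nu> - \<xi>)) \<bullet> x)))"
  proof (rule Bochner_Integration.integral_cong[OF refl])
    fix x
    have "cis (2 * pi * (\<nu> \<bullet> x)) * cis (- (2 * pi * ((x + h) \<bullet> \<xi>)))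
        = cis (- (2 * pi * (h \<bullet> \<xi>))) * cis (((2 * pi) *\<^sub>R (\<nu> - \<xi>)) \<bullet> x)"
      by (simp add: cis_mult inner_add_left inner_diff_left inner_commute algebra_simps)
    then show "gchar \<nu> c h (x + h) * cis (- (2 * pi * ((x + h) \<bullet> \<xi>))) = (cis (- (2 * pi * (h \<bullet> \<xi>))) * c) *
        (of_real (exp (- (norm x)\<^sup>2 / 2)) * cis (((2 * pi) *\<^sub>R (\<nu> - \<xi>)) \<bullet> x))"
      by (simp add: gchar_def mult.assoc mult.left_commute)
  qed
  also have "\<dots> = (cis (- (2 * pi * (h \<bullet> \<xi>))) * c) *
      of_real (sqrt (2 * pi) ^ CARD('n) * exp (- (norm ((2 * pi) *\<^sub>R (\<nu> - \<xi>)))\<^sup>2 / 2))"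
    by (intro has_bochner_integral_integral_eq has_bochner_integral_mult_right gaussian_has_fourier_vec)
  \<comment> \<open>Half the square of the \<open>2 * pi\<close> in the Fourier kernel produces the
    constant \<open>2 * pi\<^sup>2\<close>.\<close>
  also have "- (norm ((2 * pi) *\<^sub>R (\<nu> - \<xi>)))\<^sup>2 / 2 = - (2 * pi\<^sup>2) * (norm (\<xi> - \<nu>))\<^sup>2"
    by (simp add: power_mult_distrib norm_minus_commute)
  finally show ?thesis by (simp add: mult.assoc)
qed

text \<open>The phase that translation puts on the Fourier transform cancels against the kernel
  evaluated at y + h, so the shift survives only in the symbol.\<close>

lemma psdo_gchar_shift:
  "psdo a (gchar \<nu> c h) (y + h) =
    (LINT \<xi>|lborel. cis (2 * pi * (\<xi> \<bullet> y)) * a (y + h, \<xi>) * fourier (gchar \<nu> c 0) \<xi>)"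
  unfolding psdo_def
proof (rule Bochner_Integration.integral_cong[OF refl])
  fix \<xi>
  have 1: "cis (2 * pi * (\<xi> \<bullet> (y + h))) * cis (- (2 * pi * (h \<bullet> \<xi>))) = cis (2 * pi * (\<xi> \<bullet> y))"
    by (simp add: cis_mult inner_add_right inner_commute[of h] algebra_simps)
  have "fourier (gchar \<nu> c h) \<xi> = cis (- (2 * pi * (h \<bullet> \<xi>))) * fourier (gchar \<nu> c 0) \<xi>"
    by (simp add: fourier_gchar)
  then have "cis (2 * pi * (\<xi> \<bullet> (y + h))) * a (y + h, \<xi>) * fourier (gchar \<nu> c h) \<xi> =
      (cis (2 * pi * (\<xi> \<bullet> (y + h))) * cis (- (2 * pi * (h \<bullet> \<xi>)))) * a (y + h, \<xi>) * fourier (gchar \<nu> c 0) \<xi>"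
    by (simp only: mult_ac)
  then show "cis (2 * pi * (\<xi> \<bullet> (y + h))) * a (y + h, \<xi>) * fourier (gchar \<nu> c h) \<xi>
      = cis (2 * pi * (\<xi> \<bullet> y)) * a (y + h, \<xi>) * fourier (gchar \<nu> c 0) \<xi>"
    by (simp only: 1)
qed

lemma psdo_gchar_shift_tendsto:
  fixes a :: "(real^'n::finite) \<times> (real^'n) \<Rightarrow> complex"
  assumes cont: "continuous_on UNIV a" and B: "\<And>z. norm (a z) \<le> B"
    and lim: "\<And>\<xi>. (\<lambda>n. a (y + h n, \<xi>)) \<longlonglongrightarrow> a (y, \<xi>)"
  shows "(\<lambda>n. psdo a (gchar \<nu> c (h n)) (y + h n)) \<longlonglongrightarrow> psdo a (gchar \<nu> c 0) y"
proof -
  let ?F = "fourier (gchar \<nu> c 0)"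
  have [measurable]: "(\<lambda>\<xi>. a (x, \<xi>)) \<in> borel_measurable borel" for x
    by (intro borel_measurable_continuous_onI continuous_on_compose2[OF cont] continuous_intros) auto
  have Fm [measurable]: "?F \<in> borel_measurable borel"
    by (simp add: fourier_gchar[abs_def])
  \<comment> \<open>This majorant is free of h, because the shift has been moved into the bounded
    symbol.\<close>
  have Fi: "integrable lborel (\<lambda>\<xi>. B * norm (?F \<xi>))"
  proof -
    have "integrable lborel (\<lambda>\<xi>. B * (norm c * sqrt (2 * pi) ^ CARD('n)) * exp (- (2 * pi\<^sup>2) * (norm (\<xi> - \<nu>))\<^sup>2))"
      by (intro Bochner_Integration.integrable_mult_right integrable_gaussian) simp
    then show ?thesis by (simp add: fourier_gchar norm_mult mult.assoc)
  qed
  have "(\<lambda>n. LINT \<xi>|lborel. cis (2 * pi * (\<xi> \<bullet> y)) * a (y + h n, \<xi>) * ?F \<xi>) \<longlonglongrightarrow>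
      (LINT \<xi>|lborel. cis (2 * pi * (\<xi> \<bullet> y)) * a (y, \<xi>) * ?F \<xi>)"
  proof (rule integral_dominated_convergence[OF _ _ Fi])
    show "AE \<xi> in lborel. (\<lambda>n. cis (2 * pi * (\<xi> \<bullet> y)) * a (y + h n, \<xi>) * ?F \<xi>) \<longlonglongrightarrow>
        cis (2 * pi * (\<xi> \<bullet> y)) * a (y, \<xi>) * ?F \<xi>"
      by (intro AE_I2 tendsto_intros lim)
    show "AE \<xi> in lborel. norm (cis (2 * pi * (\<xi> \<bullet> y)) * a (y + h n, \<xi>) * ?F \<xi>) \<le> B * norm (?F \<xi>)" for n
      by (intro AE_I2) (simp add: norm_mult mult_right_mono B)
  qed simp_all
  then show ?thesis
    by (simp add: psdo_gchar_shift) (simp add: psdo_def)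
qed

theorem proposition6p3:
  fixes \<rho> \<delta> :: real
    and a :: "(real^'n::finite) \<times> (real^'n) \<Rightarrow> complex"
    and T :: "'n l2 \<Rightarrow> 'n l2"
  assumes "0 < \<rho>" "\<rho> \<le> 1"
    and "0 \<le> \<delta>" "\<delta> < 1"
    and "\<delta> \<le> \<rho>"
    and "a \<in> APS0 \<rho> \<delta>"
    and "psdo_l2_extension a T"
  shows "T \<noteq> (\<lambda>u. 0) \<longrightarrow> \<not> compact_operator T"
proof (intro impI notI)
  assume "T \<noteq> (\<lambda>u. 0)" and comp: "compact_operator T"
  have T: "bounded_linear T"
    and ext: "\<And>f. f \<in> schwartz \<Longrightarrow> AE x in lborel. rep_l2 (T (abs_l2 f)) x = psdo a f x"
    using assms(7) by (auto simp: psdo_l2_extension_def)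
  obtain h :: "nat \<Rightarrow> real^'n" where h: "filterlim (\<lambda>n. norm (h n)) at_top sequentially"
    and rec: "\<And>x \<xi>. (\<lambda>n. a (x + h n, \<xi>)) \<longlonglongrightarrow> a (x, \<xi>)"
    by (rule APS0_recurrence[OF assms(6) less_imp_le[OF assms(1)]]) (rule that)
  obtain B where B: "\<And>z. norm (a z) \<le> B" using APS0_bounded[OF assms(6)] by blast
  have "T (abs_l2 (gchar \<nu> c 0)) = 0" for \<nu> c
  proof -
    define u where "u n = abs_l2 (gchar \<nu> c (h n))" for n
    obtain r :: "nat \<Rightarrow> nat" where r: "strict_mono r" and Tu: "(\<lambda>n. T (u (r n))) \<longlonglongrightarrow> 0"
    proof (rule compact_operator_weakly_null[OF comp])
      show "norm (u n) \<le> norm (abs_l2 (gchar \<nu> c 0))" for n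
        unfolding u_def by (rule eq_refl[OF norm_abs_l2_gchar])
      show "(\<lambda>m. u n \<bullet> u m) \<longlonglongrightarrow> 0" for n
        unfolding u_def by (rule gchar_translates_weakly_null[OF h])
    qed
    define F where "F = rep_l2 (T (abs_l2 (gchar \<nu> c 0)))"
    \<comment> \<open>The images moved back to the origin: their norms still tend to 0 by
      translation invariance, while their pointwise limit is the image of the untranslated
      Gaussian.\<close>
    define k where "k n y = rep_l2 (T (u (r n))) (y + h (r n))" for n y
    have rep_m [measurable]: "rep_l2 v \<in> borel_measurable borel" for v :: "'n l2"
      using square_int_rep_l2[of v] by (simp add: square_int_def)
    have k_int: "(\<integral>\<^sup>+ y. ennreal ((norm (k n y))\<^sup>2) \<partial>lborel) = ennreal ((norm (T (u (r n))))\<^sup>2)" for n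
      unfolding k_def nn_integral_rep_l2[symmetric]
      by (rule nn_integral_lborel_translate[of "\<lambda>y. ennreal ((norm (rep_l2 (T (u (r n))) y))\<^sup>2)"]) measurable
    have "AE y in lborel. k n y = psdo a (gchar \<nu> c (h (r n))) (y + h (r n))" for n
      unfolding k_def u_def by (rule AE_lborel_translate) (intro ext gchar_schwartz)
    \<comment> \<open>Representatives agree with the integral formula off a null set depending on n;
      countably many null sets are collected before letting n grow.\<close>
    then have "AE y in lborel. \<forall>n. k n y = psdo a (gchar \<nu> c (h (r n))) (y + h (r n))"
      by (simp add: AE_all_countable)
    moreover have "AE y in lborel. F y = psdo a (gchar \<nu> c 0) y"
      unfolding F_def by (intro ext gchar_schwartz)
    ultimately have "AE y in lborel. (\<lambda>n. k n y) \<longlonglongrightarrow> F y"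
    proof eventually_elim
      case (elim y)
      have "(\<lambda>n. psdo a (gchar \<nu> c (h n)) (y + h n)) \<longlonglongrightarrow> psdo a (gchar \<nu> c 0) y"
        by (intro psdo_gchar_shift_tendsto[OF APS0_continuous[OF assms(6)] B] rec)
      from LIMSEQ_subseq_LIMSEQ[OF this r] elim show ?case
        by (simp add: o_def)
    qed
    then have "AE y in lborel. ennreal ((norm (F y))\<^sup>2) = liminf (\<lambda>n. ennreal ((norm (k n y))\<^sup>2))"
    proof eventually_elim
      case (elim y)
      then have "(\<lambda>n. ennreal ((norm (k n y))\<^sup>2)) \<longlonglongrightarrow> ennreal ((norm (F y))\<^sup>2)"
        by (intro tendsto_ennrealI tendsto_intros)
      then show ?case by (rule lim_imp_Liminf[OF trivial_limit_sequentially, symmetric])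
    qed
    then have "(\<integral>\<^sup>+ y. ennreal ((norm (F y))\<^sup>2) \<partial>lborel)
        = (\<integral>\<^sup>+ y. liminf (\<lambda>n. ennreal ((norm (k n y))\<^sup>2)) \<partial>lborel)"
      by (rule nn_integral_cong_AE)
    also have "\<dots> \<le> liminf (\<lambda>n. \<integral>\<^sup>+ y. ennreal ((norm (k n y))\<^sup>2) \<partial>lborel)"
      by (rule nn_integral_liminf) (simp add: k_def[abs_def])
    also have "\<dots> = liminf (\<lambda>n. ennreal ((norm (T (u (r n))))\<^sup>2))"
      by (simp only: k_int)
    also have "liminf (\<lambda>n. ennreal ((norm (T (u (r n))))\<^sup>2)) = ennreal ((norm (0::'n l2))\<^sup>2)"
      by (rule lim_imp_Liminf[OF trivial_limit_sequentially
            tendsto_ennrealI[OF tendsto_power[OF tendsto_norm[OF Tu]]]])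
    finally have "ennreal ((norm (T (abs_l2 (gchar \<nu> c 0))))\<^sup>2) \<le> ennreal ((norm (0 :: 'n l2))\<^sup>2)"
      unfolding F_def nn_integral_rep_l2 .
    then have "(norm (T (abs_l2 (gchar \<nu> c 0))))\<^sup>2 \<le> (norm (0 :: 'n l2))\<^sup>2"
      by (subst (asm) ennreal_le_iff) auto
    then show ?thesis by simp
  qed
  then have "T = (\<lambda>u. 0)"
    by (intro HOL.ext) (rule eq_0_if_gchar_null[OF T])
  with \<open>T \<noteq> (\<lambda>u. 0)\<close> show False by contradiction
qed

end
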